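(* Let $P$ be a convex Euclidean $n$-gon. For any placement of the interior marked point $p$ in the interior of $P$, the resulting punctured polygon $P^\star$ satisfies $\operatorname{diam}(\mathcal{F}(P^\star))\le 2n-6$. In addition, there exists a placement of the interior marked point $p$ in the interior of $P$ such that the resulting punctured polygon $P^\star$ satisfies $\operatorname{diam}(\mathcal{F}(P^\star))\ge 2n-8$.
   Context: Let $P$ be a convex Euclidean $n$-gon ($n\ge 3$). A punctured polygon $P^\star$ is $P$ together with a chosen point $p$ in its interior, called the puncture (or interior marked point). The marked points of $P^\star$ are the $n$ vertices of $P$ and $p$. An arc of $P^\star$ is a Euclidean line segment joining two distinct marked points, with no marked point in its interior. Two arcs are non-crossing if their interiors are disjoint. A triangulation of $P^\star$ is a maximal set of pairwise non-crossing arcs (it contains the boundary edges of $P$, and $p$ is a vertex of it). The flip-graph $\mathcal{F}(P^\star)$ has as vertices the triangulations of $P^\star$, and two of them are joined by an edge exactly when they differ by a single arc (equivalently, one is obtained from the other by exchanging the diagonals of a convex quadrilateral). The diameter $\operatorname{diam}$ of a connected graph is the largest graph distance between two of its vertices. *)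

theory Defs
  imports
    "HOL-Analysis.Analysis"
    "Graph_Theory.Pair_Digraph"
    "Graph_Theory.Shortest_Path"
begin

definition polygon_vertices :: "(real^2) set \<Rightarrow> (real^2) set" where
  "polygon_vertices P = {v. v extreme_point_of P}"

text \<open>
  A polygon is the filled, two-dimensional region. Its vertices are its extreme points, so the
  angle at each vertex is strictly less than a straight angle.
\<close>
definition convex_ngon :: "nat \<Rightarrow> (real^2) set \<Rightarrow> bool" where
  "convex_ngon n P \<longleftrightarrow> polytope P \<and> aff_dim P = 2 \<and> card (polygon_vertices P) = n"

definition marked_points :: "(real^2) set \<Rightarrow> real^2 \<Rightarrow> (real^2) set" where
  "marked_points P p = insert p (polygon_vertices P)"

text \<open>
  The definitions up to the flip-graph depend on the punctured polygon only through its set \<open>M\<close> of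
  marked points. An arc is the closed segment itself, as a set of points; its interior is the
  relative interior, that is, the open segment.
\<close>
definition segment_arcs :: "(real^2) set \<Rightarrow> (real^2) set set" where
  "segment_arcs M = {closed_segment a b | a b. a \<in> M \<and> b \<in> M \<and> a \<noteq> b \<and> open_segment a b \<inter> M = {}}"

definition noncrossing :: "(real^2) set \<Rightarrow> (real^2) set \<Rightarrow> bool" where
  "noncrossing s t \<longleftrightarrow> rel_interior s \<inter> rel_interior t = {}"

definition noncrossing_arc_set :: "(real^2) set \<Rightarrow> (real^2) set set \<Rightarrow> bool" where
  "noncrossing_arc_set M T \<longleftrightarrow> T \<subseteq> segment_arcs M \<and> pairwise noncrossing T"

definition triangulation_of :: "(real^2) set \<Rightarrow> (real^2) set set \<Rightarrow> bool" where
  "triangulation_of M T \<longleftrightarrow>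
     noncrossing_arc_set M T \<and> (\<forall>T'. noncrossing_arc_set M T' \<and> T \<subseteq> T' \<longrightarrow> T' = T)"

definition differ_by_one_arc :: "(real^2) set set \<Rightarrow> (real^2) set set \<Rightarrow> bool" where
  "differ_by_one_arc T T' \<longleftrightarrow> card (T - T') = 1 \<and> card (T' - T) = 1"

text \<open>An undirected graph is represented as a symmetric digraph.\<close>
definition flip_graph :: "(real^2) set \<Rightarrow> (real^2) set set pair_pre_digraph" where
  "flip_graph M =
     \<lparr> pverts = {T. triangulation_of M T},
       parcs = {(T, T'). triangulation_of M T \<and> triangulation_of M T' \<and> differ_by_one_arc T T'} \<rparr>"

lemma pair_graph_flip_graph:
  assumes "finite M"
  shows "pair_graph (flip_graph M)"
proof -
  have "segment_arcs M \<subseteq> (\<lambda>(a, b). closed_segment a b) ` (M \<times> M)"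
    by (auto simp: segment_arcs_def)
  then have "finite (segment_arcs M)"
    using assms by (meson finite_SigmaI finite_imageI finite_subset)
  moreover have "{T. triangulation_of M T} \<subseteq> Pow (segment_arcs M)"
    by (auto simp: triangulation_of_def noncrossing_arc_set_def)
  ultimately have fin: "finite {T. triangulation_of M T}"
    by (meson finite_Pow_iff finite_subset)
  have "{(T, T'). triangulation_of M T \<and> triangulation_of M T' \<and> differ_by_one_arc T T'}
      \<subseteq> {T. triangulation_of M T} \<times> {T. triangulation_of M T}"
    by auto
  then have fin': "finite {(T, T'). triangulation_of M T \<and> triangulation_of M T' \<and> differ_by_one_arc T T'}"
    using fin by (meson finite_SigmaI finite_subset)
  show ?thesis
    using fin fin'
    by unfold_locales
      (auto simp: flip_graph_def differ_by_one_arc_def symmetric_def arcs_ends_conv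
            intro!: symI)
qed

text \<open>
  Path length is cost under unit weights. The distance between vertices in different components
  is \<open>\<infinity>\<close>, so a finite upper bound on the diameter includes connectedness.
\<close>
definition graph_dist :: "'a pair_pre_digraph \<Rightarrow> 'a \<Rightarrow> 'a \<Rightarrow> ereal" where
  "graph_dist G u v = wf_digraph.\<mu> (with_proj G) (\<lambda>_. 1) u v"

definition graph_diam :: "'a pair_pre_digraph \<Rightarrow> ereal" where
  "graph_diam G = (SUP (u, v) \<in> pverts G \<times> pverts G. graph_dist G u v)"

end

theory Submission
  imports Defs
begin

text \<open>
  Upper bound: let \<open>p\<close> be the puncture. As long as some vertex is not joined to \<open>p\<close>, there is a flip
  that increases the degree of \<open>p\<close>. Degrees are at least 3 and the only triangulation in which \<open>p\<close>
  has full degree \<open>n\<close> is a common target, so any two triangulations are at distance at most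
  \<open>2 (n - 3)\<close>.

  Lower bound: place \<open>p\<close> close to the midpoint of an edge \<open>ab\<close> of \<open>P\<close>, and compare a triangulation
  containing all arcs from \<open>a\<close> with one containing all arcs from \<open>b\<close>. Apart from the boundary edges,
  \<open>n - 3\<close> arcs from \<open>a\<close> have to disappear and \<open>n - 3\<close> arcs from \<open>b\<close> have to appear, and no flip does
  both at once, because then \<open>p\<close> would only be joined to \<open>a\<close> and \<open>b\<close>. This even gives \<open>2n - 6\<close>.

  A segment between two vertices of \<open>P\<close> cuts \<open>P\<close> along its whole line, so that crossings are
  determined by the orientations of triples of points.
\<close>

section \<open>Distances in undirected graphs\<close>

lemma graph_dist_le_relpow:
  assumes "pair_wf_digraph G" "u \<in> pverts G" "(u, v) \<in> parcs G ^^ k"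
  shows "graph_dist G u v \<le> ereal (real k)"
proof -
  interpret pair_wf_digraph G by fact
  have "\<exists>es. awalk u es v \<and> length es = k"
    using assms(2,3)
  proof (induction k arbitrary: u)
    case 0
    then show ?case
      by (auto simp: awalk_Nil_iff)
  next
    case (Suc k)
    then obtain x where x: "(u, x) \<in> parcs G" "(x, v) \<in> parcs G ^^ k"
      by (meson relpow_Suc_D2)
    then have "x \<in> pverts G"
      using in_arcsD2 by auto
    then obtain es where "awalk x es v" "length es = k"
      using Suc.IH x by blast
    then show ?case
      using x by (intro exI[of _ "(u, x) # es"]) (simp add: awalk_Cons_iff)
  qed
  then obtain es where es: "awalk u es v" "length es = k"
    by blast
  have "awalk_cost (\<lambda>_. 1) es = real (length es)"
    by (induction es) auto
  then show ?thesis
    using min_cost_le_walk_cost[OF es(1), of "\<lambda>_. 1"] es(2) by (simp add: graph_dist_def)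
qed

text \<open>Telescoping along a walk: each arc costs one and raises \<open>\<Phi>\<close> by at most
  one. Vertices without a connecting walk are at infinite distance, which satisfies the bound
  too.\<close>

lemma graph_dist_ge_potential:
  assumes "pair_wf_digraph G" "\<And>x y. (x, y) \<in> parcs G \<Longrightarrow> \<Phi> y \<le> \<Phi> x + (1 :: real)"
  shows "ereal (\<Phi> v - \<Phi> u) \<le> graph_dist G u v"
proof -
  interpret pair_wf_digraph G by fact
  have "\<Phi> v - \<Phi> u \<le> awalk_cost (\<lambda>_. 1) es" if "awalk u es v" for es
    using that
  proof (induction es arbitrary: u)
    case (Cons e es)
    then show ?case
      using assms(2)[of "fst e" "snd e"] by (force simp: awalk_Cons_iff)
  qed (simp add: awalk_Nil_iff)
  then show ?thesis
    unfolding graph_dist_def \<mu>_def by (intro INF_greatest) auto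
qed

lemma relpow_sym:
  assumes "sym R" "(x, y) \<in> R ^^ k"
  shows "(y, x) \<in> R ^^ k"
  using assms(2)
proof (induction k arbitrary: y)
  case (Suc k)
  then obtain z where "(x, z) \<in> R ^^ k" "(z, y) \<in> R"
    by auto
  then show ?case
    using Suc.IH assms(1) by (meson relpow_Suc_I2 symD)
qed simp

lemma pair_wf_digraph_flip_graph: "pair_wf_digraph (flip_graph M)"
  by unfold_locales (auto simp: flip_graph_def)

section \<open>Orientation of triples of points\<close>

text \<open>Twice the signed area of the triangle \<open>x y z\<close>, positive when it is
  traversed counterclockwise.\<close>

definition orient :: "real^2 \<Rightarrow> real^2 \<Rightarrow> real^2 \<Rightarrow> real" where
  "orient x y z = (y$1 - x$1) * (z$2 - x$2) - (y$2 - x$2) * (z$1 - x$1)"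

text \<open>Only one of the two side conditions for crossing segments. When \<open>u\<close> and
  \<open>w\<close> are vertices it suffices, because inside the polygon the line through them is
  just the segment.\<close>

definition sep :: "real^2 \<Rightarrow> real^2 \<Rightarrow> real^2 \<Rightarrow> real^2 \<Rightarrow> bool" where
  "sep u w x y \<longleftrightarrow> orient u w x * orient u w y < 0"

lemma orient_rotate: "orient y z x = orient x y z"
  by (simp add: orient_def algebra_simps)

lemma orient_swap: "orient y x z = - orient x y z"
  by (simp add: orient_def algebra_simps)

lemma orient_same [simp]: "orient x x y = 0" "orient x y x = 0" "orient y x x = 0"
  by (simp_all add: orient_def)

lemma orient_affine:
  "orient u w ((1 - t) *\<^sub>R x + t *\<^sub>R y) = (1 - t) * orient u w x + t * orient u w y"
  by (simp add: orient_def algebra_simps)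

lemma sep_swap: "sep w u x y \<longleftrightarrow> sep u w x y"
  by (simp add: sep_def orient_swap[of w u])

lemma sep_distinct:
  assumes "sep u w x y"
  shows "u \<noteq> w" "x \<noteq> y" "x \<noteq> u" "x \<noteq> w" "y \<noteq> u" "y \<noteq> w"
  using assms by (auto simp: sep_def not_less)

lemma orient_zero_imp_affine:
  assumes "u \<noteq> w" "orient u w x = 0"
  obtains s where "x = (1 - s) *\<^sub>R u + s *\<^sub>R w"
proof -
  have "\<exists>s. x$1 - u$1 = s * (w$1 - u$1) \<and> x$2 - u$2 = s * (w$2 - u$2)"
  proof (cases "w$1 = u$1")
    case True
    then have "w$2 \<noteq> u$2"
      using assms(1) by (auto simp: vec_eq_iff forall_2)
    then show ?thesis
      using assms(2) True by (intro exI[of _ "(x$2 - u$2) / (w$2 - u$2)"]) (simp add: orient_def)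
  next
    case False
    then show ?thesis
      using assms(2) by (intro exI[of _ "(x$1 - u$1) / (w$1 - u$1)"])
        (simp add: orient_def field_simps)
  qed
  then obtain s where "x$1 - u$1 = s * (w$1 - u$1)" "x$2 - u$2 = s * (w$2 - u$2)"
    by blast
  then have "x = (1 - s) *\<^sub>R u + s *\<^sub>R w"
    by (simp add: vec_eq_iff forall_2 algebra_simps)
  then show ?thesis
    by (rule that)
qed

lemma open_segmentE:
  assumes "q \<in> open_segment x y"
  obtains t where "0 < t" "t < 1" "q = (1 - t) *\<^sub>R x + t *\<^sub>R y" "x \<noteq> y"
  using assms by (auto simp: in_segment)

lemma orient_open_segment:
  assumes "q \<in> open_segment x y"
  obtains t where "0 < t" "t < 1" "\<And>u w. orient u w q = (1 - t) * orient u w x + t * orient u w y"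
  using assms orient_affine by (metis open_segmentE)

text \<open>The factor \<open>s\<close> carries only a sign, so that one statement serves both sides
  of the line.\<close>

lemma open_segment_strict_side:
  assumes "q \<in> open_segment x y" "orient u w x * s > 0" "orient u w y * s \<ge> 0"
  shows "orient u w q * s > 0"
proof -
  obtain t where t: "0 < t" "t < 1" "orient u w q = (1 - t) * orient u w x + t * orient u w y"
    using orient_open_segment[OF assms(1)] by metis
  have "orient u w q * s = (1 - t) * (orient u w x * s) + t * (orient u w y * s)"
    unfolding t(3) by (simp add: algebra_simps)
  moreover have "(1 - t) * (orient u w x * s) > 0" "t * (orient u w y * s) \<ge> 0"
    using t assms by simp_all
  ultimately show ?thesis by linarith
qed

text \<open>If \<open>z\<close> were on the side of \<open>p\<close> or on the line, every point
  strictly between would be strictly on the side of \<open>p\<close>.\<close>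

lemma sep_beyond:
  assumes "q \<in> open_segment p z" "sep u w p q"
  shows "sep u w p z"
proof (rule ccontr)
  assume "\<not> ?thesis"
  moreover have "orient u w p \<noteq> 0"
    using assms(2) by (auto simp: sep_def)
  ultimately have "orient u w q * orient u w p > 0"
    by (intro open_segment_strict_side[OF assms(1)])
      (auto simp: sep_def not_less mult.commute zero_less_mult_iff linorder_neq_iff)
  then show False
    using assms(2) by (simp add: sep_def mult.commute)
qed

section \<open>Crossing arcs of a punctured polygon\<close>

definition crosses :: "(real^2) set \<Rightarrow> (real^2) set \<Rightarrow> bool" where
  "crosses e f \<longleftrightarrow> e \<noteq> f \<and> \<not> noncrossing e f"

lemma crosses_commute: "crosses e f \<longleftrightarrow> crosses f e"
  by (auto simp: crosses_def noncrossing_def)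

lemma crosses_closed_segment:
  assumes "a \<noteq> b" "c \<noteq> d"
  shows "crosses (closed_segment a b) (closed_segment c d) \<longleftrightarrow>
    {a, b} \<noteq> {c, d} \<and> open_segment a b \<inter> open_segment c d \<noteq> {}"
  using assms by (simp add: crosses_def noncrossing_def rel_interior_closed_segment)

lemma noncrossing_arc_set_iff:
  "noncrossing_arc_set M T \<longleftrightarrow> T \<subseteq> segment_arcs M \<and> (\<forall>e\<in>T. \<forall>f\<in>T. \<not> crosses e f)"
  by (auto simp: noncrossing_arc_set_def pairwise_def crosses_def)

text \<open>Maximality can be tested one arc at a time: each arc of a larger non-crossing set
  crosses no arc of \<open>T\<close> and can be added alone.\<close>

lemma triangulation_of_iff:
  "triangulation_of M T \<longleftrightarrow> noncrossing_arc_set M T \<and>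
     (\<forall>e\<in>segment_arcs M. (\<forall>f\<in>T. \<not> crosses e f) \<longrightarrow> e \<in> T)"
proof (intro iffI conjI ballI impI)
  assume T: "triangulation_of M T"
  show nc: "noncrossing_arc_set M T"
    using T by (simp add: triangulation_of_def)
  fix e assume e: "e \<in> segment_arcs M" "\<forall>f\<in>T. \<not> crosses e f"
  then have "\<forall>f\<in>T. \<not> crosses f e"
    using crosses_commute by blast
  moreover have "\<not> crosses e e"
    by (simp add: crosses_def)
  ultimately have "noncrossing_arc_set M (insert e T)"
    using nc e by (simp add: noncrossing_arc_set_iff)
  then have "insert e T = T"
    using T by (simp add: triangulation_of_def subset_insertI)
  then show "e \<in> T"
    by blast
next
  assume *: "noncrossing_arc_set M T \<and>
     (\<forall>e\<in>segment_arcs M. (\<forall>f\<in>T. \<not> crosses e f) \<longrightarrow> e \<in> T)"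
  have "T' = T" if T': "noncrossing_arc_set M T'" "T \<subseteq> T'" for T'
  proof -
    have "e \<in> T" if "e \<in> T'" for e
    proof -
      have "e \<in> segment_arcs M" "\<forall>f\<in>T. \<not> crosses e f"
        using T' that unfolding noncrossing_arc_set_iff by blast+
      then show ?thesis
        using * by blast
    qed
    then show ?thesis
      using T' by blast
  qed
  then show "triangulation_of M T"
    using * by (simp add: triangulation_of_def)
qed

lemma finite_segment_arcs:
  assumes "finite M"
  shows "finite (segment_arcs M)"
proof -
  have "segment_arcs M \<subseteq> (\<lambda>(a, b). closed_segment a b) ` (M \<times> M)"
    by (auto simp: segment_arcs_def)
  then show ?thesis
    using assms by (meson finite_SigmaI finite_imageI finite_subset)
qed

lemma noncrossing_arc_set_extends:
  assumes "finite M" "noncrossing_arc_set M S"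
  obtains T where "triangulation_of M T" "S \<subseteq> T"
proof -
  let ?F = "{T. noncrossing_arc_set M T \<and> S \<subseteq> T}"
  have "?F \<subseteq> Pow (segment_arcs M)"
    by (auto simp: noncrossing_arc_set_def)
  then have "finite ?F"
    using finite_segment_arcs[OF assms(1)] by (meson finite_Pow_iff finite_subset)
  moreover have "?F \<noteq> {}"
    using assms(2) by auto
  ultimately obtain T where "T \<in> ?F" "\<forall>T'\<in>?F. T \<subseteq> T' \<longrightarrow> T = T'"
    using finite_has_maximal[of ?F] by metis
  then have "triangulation_of M T"
    by (auto simp: triangulation_of_def)
  then show ?thesis
    using that \<open>T \<in> ?F\<close> by blast
qed

locale punctured_polygon =
  fixes P V :: "(real^2) set" and p :: "real^2"
  assumes finite_V: "finite V"
    and V_eq: "V = polygon_vertices P"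
    and P_hull: "P = convex hull V"
    and p_interior: "p \<in> interior P"
begin

abbreviation "M \<equiv> insert p V"

lemma p_in_P: "p \<in> P"
  using p_interior interior_subset by blast

lemma V_in_P: "v \<in> V \<Longrightarrow> v \<in> P"
  by (simp add: V_eq polygon_vertices_def extreme_point_of_def)

lemma M_in_P: "v \<in> M \<Longrightarrow> v \<in> P"
  using V_in_P p_in_P by blast

lemma convex_P: "convex P"
  by (simp add: P_hull)

lemma p_notin_V: "p \<notin> V"
  using p_interior extreme_point_not_in_interior by (auto simp: V_eq polygon_vertices_def)

lemma vertex_extreme: "v \<in> V \<Longrightarrow> x \<in> P \<Longrightarrow> y \<in> P \<Longrightarrow> v \<notin> open_segment x y"
  by (simp add: V_eq polygon_vertices_def extreme_point_of_def)

text \<open>A point of \<open>P\<close> on the line but beyond \<open>u\<close> would put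
  \<open>u\<close> strictly between it and \<open>w\<close>, contradicting that \<open>u\<close> is
  extreme; likewise beyond \<open>w\<close>.\<close>

lemma orient_zero_imp_segment:
  assumes "u \<in> V" "w \<in> V" "u \<noteq> w" "x \<in> P" "orient u w x = 0"
  shows "x \<in> closed_segment u w"
proof -
  obtain s where s: "x = (1 - s) *\<^sub>R u + s *\<^sub>R w"
    using orient_zero_imp_affine assms by metis
  have "s \<ge> 0"
  proof (rule ccontr)
    assume "\<not> s \<ge> 0"
    \<comment> \<open>The equation for \<open>x\<close> is solved for \<open>u\<close>, which gets
      the parameter \<open>- s / (1 - s)\<close> on the segment from \<open>x\<close> to
      \<open>w\<close>.\<close>
    then have s1: "1 - (- s / (1 - s)) = 1 / (1 - s)" "1 - s \<noteq> 0"
      by (simp_all add: field_simps)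
    have "(1 - s) *\<^sub>R u = x - s *\<^sub>R w"
      using s by simp
    then have "(1 / (1 - s)) *\<^sub>R ((1 - s) *\<^sub>R u) = (1 / (1 - s)) *\<^sub>R (x - s *\<^sub>R w)"
      by simp
    then have "u = (1 - (- s / (1 - s))) *\<^sub>R x + (- s / (1 - s)) *\<^sub>R w"
      unfolding s1(1) using s1(2) by (simp add: scaleR_diff_right)
    moreover have "x \<noteq> w"
    proof
      assume "x = w"
      then have "(1 - s) *\<^sub>R (u - w) = 0"
        using s by (simp add: algebra_simps)
      then show False using assms(3) \<open>\<not> s \<ge> 0\<close> by simp
    qed
    ultimately have "u \<in> open_segment x w"
      unfolding in_segment using \<open>\<not> s \<ge> 0\<close>
      by (intro conjI exI[of _ "- s / (1 - s)"]) (auto simp: field_simps)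
    then show False
      using vertex_extreme assms V_in_P by blast
  qed
  moreover have "s \<le> 1"
  proof (rule ccontr)
    assume "\<not> s \<le> 1"
    then have "w = (1 - 1 / s) *\<^sub>R u + (1 / s) *\<^sub>R x"
      by (simp add: s vec_eq_iff forall_2 field_simps)
    moreover have "x \<noteq> u"
    proof
      assume "x = u"
      then have "s *\<^sub>R (w - u) = 0"
        using s by (simp add: algebra_simps)
      then show False using assms(3) \<open>\<not> s \<le> 1\<close> by simp
    qed
    ultimately have "w \<in> open_segment u x"
      unfolding in_segment using \<open>\<not> s \<le> 1\<close>
      by (intro conjI exI[of _ "1 / s"]) auto
    then show False
      using vertex_extreme assms V_in_P by blast
  qed
  ultimately show ?thesis
    using s by (auto simp: in_segment)
qed

lemma orient_vertices_nonzero: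
  assumes "u \<in> V" "w \<in> V" "t \<in> V" "u \<noteq> w" "t \<noteq> u" "t \<noteq> w"
  shows "orient u w t \<noteq> 0"
proof
  assume "orient u w t = 0"
  then have "t \<in> closed_segment u w"
    using orient_zero_imp_segment assms V_in_P by blast
  then have "t \<in> open_segment u w"
    using assms by (simp add: closed_segment_eq_open)
  then show False
    using vertex_extreme assms V_in_P by blast
qed

text \<open>Up to the sign \<open>s\<close> of the triangle, the three orientations are unnormalised
  barycentric coordinates of \<open>t\<close>. If all are positive, \<open>t\<close> lies strictly
  inside a segment of \<open>P\<close>, which an extreme point cannot.\<close>

lemma vertex_not_in_triangle:
  assumes "t \<in> V" "x \<in> P" "y \<in> P" "z \<in> P"
    and "orient x y t * s > 0" "orient y z t * s > 0" "orient z x t * s > 0"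
  shows False
proof -
  define a where "a = orient y z t * s"
  define b where "b = orient z x t * s"
  define c where "c = orient x y t * s"
  have pos: "a > 0" "b > 0" "c > 0"
    using assms by (simp_all add: a_def b_def c_def)
  \<comment> \<open>The point where the ray from \<open>x\<close> through \<open>t\<close> meets the
    side \<open>yz\<close>.\<close>
  define q where "q = (1 - c / (b + c)) *\<^sub>R y + (c / (b + c)) *\<^sub>R z"
  have "q \<in> closed_segment y z"
    unfolding q_def in_segment using pos by (intro exI[of _ "c / (b + c)"]) (auto simp: field_simps)
  then have "q \<in> P"
    using convex_P assms by (meson closed_segment_subset subsetD)
  have "(a + b + c) *\<^sub>R t = a *\<^sub>R x + b *\<^sub>R y + c *\<^sub>R z"
    by (simp add: vec_eq_iff forall_2 a_def b_def c_def orient_def algebra_simps)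
  moreover have "(b + c) *\<^sub>R q = b *\<^sub>R y + c *\<^sub>R z"
  proof -
    have "(b + c) * (1 - c / (b + c)) = b" "(b + c) * (c / (b + c)) = c"
      using pos by (simp_all add: right_diff_distrib)
    then show ?thesis
      unfolding q_def scaleR_add_right scaleR_scaleR by simp
  qed
  ultimately have "(a + b + c) *\<^sub>R t = a *\<^sub>R x + (b + c) *\<^sub>R q"
    by (simp add: add.assoc)
  then have "(1 / (a + b + c)) *\<^sub>R ((a + b + c) *\<^sub>R t) = (1 / (a + b + c)) *\<^sub>R (a *\<^sub>R x + (b + c) *\<^sub>R q)"
    by simp
  moreover have "1 - (b + c) / (a + b + c) = a / (a + b + c)"
    using pos by (simp add: field_simps)
  ultimately have t: "t = (1 - (b + c) / (a + b + c)) *\<^sub>R x + ((b + c) / (a + b + c)) *\<^sub>R q"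
    using pos by (simp add: scaleR_add_right)
  moreover have "x \<noteq> q"
  proof
    assume "x = q"
    then have "t = x"
      using t by (simp add: algebra_simps)
    then show False
      using assms(5) by simp
  qed
  ultimately have "t \<in> open_segment x q"
    unfolding in_segment using pos by (intro conjI exI[of _ "(b + c) / (a + b + c)"]) auto
  then show False
    using vertex_extreme assms \<open>q \<in> P\<close> by blast
qed

text \<open>The affine function \<open>orient u w\<close> has a zero on \<open>xy\<close>. This zero
  lies in \<open>P\<close> and on the line, hence on the segment \<open>uw\<close>; it is no
  endpoint since vertices are extreme.\<close>

lemma sep_imp_segments_meet:
  assumes "u \<in> V" "w \<in> V" "x \<in> P" "y \<in> P" "sep u w x y"
  obtains q where "q \<in> open_segment u w" "q \<in> open_segment x y"
proof -
  let ?f = "orient u w"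
  have ne: "?f x \<noteq> ?f y" and sgn: "?f x * ?f y < 0"
    using assms(5) by (auto simp: sep_def not_less)
  define t where "t = ?f x / (?f x - ?f y)"
  have t: "0 < t" "t < 1"
    using sgn by (auto simp: t_def field_simps mult_less_0_iff)
  define q where "q = (1 - t) *\<^sub>R x + t *\<^sub>R y"
  have q: "q \<in> open_segment x y"
    using t sep_distinct[OF assms(5)] by (auto simp: q_def in_segment)
  have "?f q = 0"
    using ne unfolding q_def orient_affine t_def by (simp add: field_simps)
  moreover have "q \<in> P"
    using q assms convex_P by (metis convex_contains_open_segment subsetD)
  ultimately have "q \<in> closed_segment u w"
    using orient_zero_imp_segment assms sep_distinct[OF assms(5)] by blast
  moreover have "q \<noteq> u" "q \<noteq> w"
    using q vertex_extreme assms by blast+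
  ultimately show ?thesis
    using q that by (auto simp: closed_segment_eq_open)
qed

lemma puncture_arc:
  assumes "v \<in> V"
  shows "closed_segment p v \<in> segment_arcs M"
proof -
  have "open_segment p v \<inter> M = {}"
    using vertex_extreme assms V_in_P p_in_P by (auto simp: open_segment_def)
  moreover have "p \<noteq> v"
    using assms p_notin_V by blast
  ultimately show ?thesis
    unfolding segment_arcs_def using assms by blast
qed

text \<open>Vertices never lie inside a segment of \<open>P\<close>, so only the puncture can block
  an arc, and it does so exactly when it is collinear with \<open>u\<close> and
  \<open>w\<close>.\<close>

lemma vertex_arc_iff:
  assumes "u \<in> V" "w \<in> V" "u \<noteq> w"
  shows "closed_segment u w \<in> segment_arcs M \<longleftrightarrow> orient u w p \<noteq> 0"
proof
  assume "closed_segment u w \<in> segment_arcs M"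
  then obtain a b where "{u, w} = {a, b}" "open_segment a b \<inter> M = {}"
    by (auto simp: segment_arcs_def)
  then have "p \<notin> open_segment u w"
    by (auto simp: doubleton_eq_iff open_segment_commute)
  then show "orient u w p \<noteq> 0"
    using orient_zero_imp_segment[of u w p] assms p_in_P p_notin_V
    by (auto simp: closed_segment_eq_open)
next
  assume "orient u w p \<noteq> 0"
  then have "p \<notin> open_segment u w"
    by (auto elim!: orient_open_segment)
  then show "closed_segment u w \<in> segment_arcs M"
    unfolding segment_arcs_def using assms vertex_extreme V_in_P by blast
qed

lemma arc_cases:
  assumes "e \<in> segment_arcs M"
  obtains (puncture) v where "v \<in> V" "e = closed_segment p v"
    | (vertices) u w where "u \<in> V" "w \<in> V" "u \<noteq> w" "orient u w p \<noteq> 0" "e = closed_segment u w"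
proof -
  obtain a b where ab: "e = closed_segment a b" "a \<in> M" "b \<in> M" "a \<noteq> b"
    using assms by (auto simp: segment_arcs_def)
  show ?thesis
  proof (cases "a = p \<or> b = p")
    case True
    then show ?thesis
      using ab puncture closed_segment_commute by (metis insertE)
  next
    case False
    then show ?thesis
      using ab vertices vertex_arc_iff assms by (metis insertE)
  qed
qed

text \<open>Since \<open>u\<close> and \<open>w\<close> are the only marked points on their line,
  distinct arcs meeting at an interior point force the endpoints of \<open>xy\<close> to strictly
  opposite sides.\<close>

lemma crosses_vertex_arc_iff:
  assumes "u \<in> V" "w \<in> V" "orient u w p \<noteq> 0" "x \<in> M" "y \<in> M" "x \<noteq> y"
  shows "crosses (closed_segment u w) (closed_segment x y) \<longleftrightarrow> sep u w x y"
proof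
  have uw: "u \<noteq> w" using assms by auto
  assume "crosses (closed_segment u w) (closed_segment x y)"
  then obtain q where ne: "{u, w} \<noteq> {x, y}" and q: "q \<in> open_segment u w" "q \<in> open_segment x y"
    using crosses_closed_segment[of u w x y] uw assms by blast
  obtain t where t: "0 < t" "t < 1" "orient u w q = (1 - t) * orient u w x + t * orient u w y"
    using orient_open_segment[OF q(2)] by metis
  have "orient u w q = 0"
    using orient_open_segment[OF q(1)] by (metis orient_same(2,3) mult_zero_right add_0)
  then have eq: "(1 - t) * orient u w x = - (t * orient u w y)"
    using t by linarith
  have "\<not> (orient u w x = 0 \<and> orient u w y = 0)"
  proof
    assume "orient u w x = 0 \<and> orient u w y = 0"
    then have "x \<in> {u, w}" "y \<in> {u, w}"
      using orient_vertices_nonzero assms uw by blast+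
    then show False
      using ne assms by auto
  qed
  then have nz: "orient u w x \<noteq> 0"
    using eq t by auto
  have ty: "t * orient u w y = - ((1 - t) * orient u w x)"
    using eq by simp
  have "t * (orient u w x * orient u w y) = orient u w x * (t * orient u w y)"
    by simp
  also have "\<dots> = - (1 - t) * (orient u w x)\<^sup>2"
    unfolding ty by (simp add: power2_eq_square algebra_simps)
  also have "\<dots> < 0"
    using t nz by (simp add: mult_less_0_iff)
  finally show "sep u w x y"
    using t by (simp add: sep_def mult_less_0_iff)
next
  assume s: "sep u w x y"
  then obtain q where "q \<in> open_segment u w" "q \<in> open_segment x y"
    using sep_imp_segments_meet assms M_in_P by metis
  then show "crosses (closed_segment u w) (closed_segment x y)"
    using crosses_closed_segment[of u w x y] sep_distinct[OF s] by auto
qed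

text \<open>Two segments from \<open>p\<close> that meet again have the same direction, so the
  nearer endpoint would lie inside the longer segment.\<close>

lemma puncture_arcs_not_cross:
  assumes "v \<in> V" "t \<in> V"
  shows "\<not> crosses (closed_segment p v) (closed_segment p t)"
proof
  assume cr: "crosses (closed_segment p v) (closed_segment p t)"
  then have "v \<noteq> t"
    by (auto simp: crosses_def)
  \<comment> \<open>By symmetry the nearer endpoint may be called \<open>v\<close>; this is what
    \<open>\<beta> \<le> \<alpha>\<close> expresses.\<close>
  have no: False if v: "v \<in> V" "t \<in> V" "v \<noteq> t" and ab: "0 < \<beta>" "\<beta> \<le> \<alpha>"
    and eq: "\<alpha> *\<^sub>R (v - p) = \<beta> *\<^sub>R (t - p)" for v t \<alpha> \<beta>
  proof -
    have "v - p = (\<beta> / \<alpha>) *\<^sub>R (t - p)"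
      using eq ab by (metis divide_inverse_commute eq_vector_fraction_iff
        less_le_trans order_less_irrefl scaleR_scaleR)
    then have v_eq: "v = (1 - \<beta> / \<alpha>) *\<^sub>R p + (\<beta> / \<alpha>) *\<^sub>R t"
      by (simp add: scaleR_diff_left scaleR_diff_right diff_eq_eq)
    moreover have "\<beta> \<noteq> \<alpha>"
      using v_eq v ab by auto
    ultimately have "v \<in> open_segment p t"
      unfolding in_segment using ab v p_notin_V
      by (intro conjI exI[of _ "\<beta> / \<alpha>"]) auto
    then show False
      using vertex_extreme v p_in_P V_in_P by blast
  qed
  obtain q where q: "q \<in> open_segment p v" "q \<in> open_segment p t"
    using cr assms p_notin_V crosses_closed_segment[of p v p t] by blast
  obtain \<alpha> where a: "0 < \<alpha>" "q = (1 - \<alpha>) *\<^sub>R p + \<alpha> *\<^sub>R v"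
    using q open_segmentE by metis
  obtain \<beta> where b: "0 < \<beta>" "q = (1 - \<beta>) *\<^sub>R p + \<beta> *\<^sub>R t"
    using q open_segmentE by metis
  have eq: "\<alpha> *\<^sub>R (v - p) = \<beta> *\<^sub>R (t - p)"
    using a(2) b(2) by (simp add: algebra_simps)
  show False
    using no[of v t \<beta> \<alpha>] no[of t v \<alpha> \<beta>] assms a(1) b(1) eq \<open>v \<noteq> t\<close> by (metis linear)
qed

section \<open>Flips that increase the degree of the puncture\<close>

lemma arc_endpoints_nonzero:
  assumes "triangulation_of M T" "u \<in> V" "w \<in> V" "u \<noteq> w" "closed_segment u w \<in> T"
  shows "orient u w p \<noteq> 0"
  using assms vertex_arc_iff by (auto simp: triangulation_of_iff noncrossing_arc_set_iff)

lemma arcs_not_sep: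
  assumes "triangulation_of M T" "u \<in> V" "w \<in> V" "u \<noteq> w" "x \<in> M" "y \<in> M" "x \<noteq> y"
    and "closed_segment u w \<in> T" "closed_segment x y \<in> T"
  shows "\<not> sep u w x y"
  using assms arc_endpoints_nonzero[of T u w] crosses_vertex_arc_iff[of u w x y]
  by (auto simp: triangulation_of_iff noncrossing_arc_set_iff)

lemma missing_vertex_arc:
  assumes "triangulation_of M T" "x \<in> V" "y \<in> V" "orient x y p \<noteq> 0" "closed_segment x y \<notin> T"
  obtains (vertices) h k where "h \<in> V" "k \<in> V" "closed_segment h k \<in> T" "sep x y h k"
    | (puncture) t where "t \<in> V" "closed_segment p t \<in> T" "sep x y p t"
proof -
  have "x \<noteq> y"
    using assms by auto
  then have "closed_segment x y \<in> segment_arcs M"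
    using assms vertex_arc_iff by blast
  then obtain f where f: "f \<in> T" "crosses (closed_segment x y) f"
    using assms by (auto simp: triangulation_of_iff)
  then have "f \<in> segment_arcs M"
    using assms by (auto simp: triangulation_of_iff noncrossing_arc_set_iff)
  then show ?thesis
  proof (cases rule: arc_cases)
    case (puncture t)
    then show ?thesis
      using that(2)[of t] f assms crosses_vertex_arc_iff[of x y p t] p_notin_V by auto
  next
    case (vertices h k)
    then show ?thesis
      using that(1)[of h k] f assms crosses_vertex_arc_iff[of x y h k] by auto
  qed
qed

section \<open>Arcs between a vertex and the puncture\<close>

definition crossing_arcs :: "(real^2) set set \<Rightarrow> real^2 \<Rightarrow> (real^2) set set" where
  "crossing_arcs T v = {e \<in> T. crosses e (closed_segment p v)}"

lemma mem_crossing_arcs: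
  assumes "triangulation_of M T" "v \<in> V" "u \<in> V" "w \<in> V" "u \<noteq> w"
  shows "closed_segment u w \<in> crossing_arcs T v \<longleftrightarrow> closed_segment u w \<in> T \<and> sep u w p v"
proof (cases "closed_segment u w \<in> T")
  case True
  then show ?thesis
    using assms arc_endpoints_nonzero[of T u w] crosses_vertex_arc_iff[of u w p v] p_notin_V
    by (auto simp: crossing_arcs_def)
qed (simp add: crossing_arcs_def)

lemma crossing_arcsE:
  assumes "triangulation_of M T" "v \<in> V" "e \<in> crossing_arcs T v"
  obtains u w where "u \<in> V" "w \<in> V" "u \<noteq> w" "e = closed_segment u w" "e \<in> T" "sep u w p v"
proof -
  have e: "e \<in> T" "crosses e (closed_segment p v)"
    using assms by (auto simp: crossing_arcs_def)
  then have "e \<in> segment_arcs M"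
    using assms by (auto simp: triangulation_of_iff noncrossing_arc_set_iff)
  then show ?thesis
  proof (cases rule: arc_cases)
    case (puncture t)
    then show ?thesis
      using puncture_arcs_not_cross e assms by blast
  next
    case (vertices u w)
    then show ?thesis
      using that e assms mem_crossing_arcs by blast
  qed
qed

lemma finite_triangulation: "triangulation_of M T \<Longrightarrow> finite T"
  using finite_segment_arcs[of M] finite_V
  by (auto simp: triangulation_of_iff noncrossing_arc_set_iff intro: finite_subset)

lemma finite_crossing_arcs: "triangulation_of M T \<Longrightarrow> finite (crossing_arcs T v)"
  using finite_triangulation by (simp add: crossing_arcs_def)

lemma crossing_arcs_empty_iff:
  assumes "triangulation_of M T" "v \<in> V"
  shows "crossing_arcs T v = {} \<longleftrightarrow> closed_segment p v \<in> T"
proof -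
  have "closed_segment p v \<in> segment_arcs M"
    using puncture_arc assms by blast
  then show ?thesis
    using assms by (auto simp: crossing_arcs_def triangulation_of_iff noncrossing_arc_set_iff
      crosses_commute)
qed

text \<open>As \<open>hk\<close> does not separate \<open>x\<close> from \<open>y\<close>, the whole
  open segment \<open>xy\<close> is beyond \<open>hk\<close> as seen from \<open>p\<close>. The
  segment \<open>pz\<close> passes through it and cannot come back.\<close>

lemma sep_through_arc:
  assumes "x \<in> V" "y \<in> V" "z \<in> V" "sep x y p z" "sep h k p x" "\<not> sep h k x y"
  shows "sep h k p z"
proof -
  obtain q where q: "q \<in> open_segment x y" "q \<in> open_segment p z"
    using sep_imp_segments_meet assms p_in_P V_in_P by metis
  have "orient h k x * - orient h k p > 0"
    using assms(5) by (simp add: sep_def mult.commute)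
  moreover from this have "orient h k y * - orient h k p \<ge> 0"
    using assms(6) by (auto simp: sep_def not_less mult_le_0_iff mult_less_0_iff)
  ultimately have "orient h k q * - orient h k p > 0"
    using open_segment_strict_side[OF q(1)] by blast
  then have "sep h k p q"
    by (simp add: sep_def mult.commute)
  then show ?thesis
    using sep_beyond q by blast
qed

text \<open>The descent step. An arc separating \<open>p\<close> from \<open>x\<close> cannot cross
  \<open>xy\<close>, so it separates \<open>p\<close> from \<open>z\<close> as well. The arc
  \<open>xy\<close> is lost because it ends at \<open>x\<close>, while \<open>uw\<close>
  stays.\<close>

lemma crossing_arcs_psubset:
  assumes T: "triangulation_of M T" and V: "z \<in> V" "u \<in> V" "w \<in> V" "x \<in> V" "y \<in> V" "x \<noteq> y"
    and in_T: "closed_segment u w \<in> T" "closed_segment x y \<in> T"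
    and s: "sep x y p z" "sep u w p x"
  shows "crossing_arcs T x \<noteq> {} \<and> crossing_arcs T x \<subset> crossing_arcs T z"
proof -
  have "closed_segment u w \<in> crossing_arcs T x"
    using mem_crossing_arcs[of T x u w] T V in_T s sep_distinct(1) by blast
  moreover have "e \<in> crossing_arcs T z" if e: "e \<in> crossing_arcs T x" for e
  proof -
    obtain h k where hk: "h \<in> V" "k \<in> V" "h \<noteq> k" "e = closed_segment h k" "e \<in> T" "sep h k p x"
      using crossing_arcsE[OF T _ e] V by metis
    then have "\<not> sep h k x y"
      using arcs_not_sep[of T h k x y] T V in_T by auto
    then show ?thesis
      using sep_through_arc hk V s mem_crossing_arcs[OF T] by blast
  qed
  moreover have "closed_segment x y \<in> crossing_arcs T z"
    using mem_crossing_arcs[of T z x y] T V in_T s by blast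
  moreover have "closed_segment x y \<notin> crossing_arcs T x"
    using mem_crossing_arcs[of T x x y] T V by (auto simp: sep_def)
  ultimately show ?thesis
    by blast
qed

text \<open>On the way from \<open>p\<close> to \<open>z\<close>, neither end of \<open>xy\<close>
  is behind the line \<open>uw\<close>, so the crossing point \<open>q\<close> is not behind it
  either and is reached no later than \<open>q'\<close>.\<close>

lemma first_crossing:
  assumes "q \<in> open_segment x y" "q = (1 - \<alpha>) *\<^sub>R p + \<alpha> *\<^sub>R z" "q' = (1 - \<beta>) *\<^sub>R p + \<beta> *\<^sub>R z"
    and "orient u w q' = 0" "sep u w p z" "\<not> sep u w p x" "\<not> sep u w p y"
  shows "\<alpha> \<le> \<beta>"
proof -
  \<comment> \<open>Multiplying by \<open>orient u w p\<close> makes the side of \<open>p\<close>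
    the positive one.\<close>
  define a where "a = orient u w p * orient u w p"
  define b where "b = orient u w p * orient u w z"
  have ab: "a > 0" "b < 0"
    using assms(5) by (auto simp: a_def b_def sep_def zero_less_mult_iff mult_less_0_iff)
  obtain t where t: "0 < t" "t < 1" "orient u w q = (1 - t) * orient u w x + t * orient u w y"
    using orient_open_segment[OF assms(1)] by metis
  have "orient u w p * orient u w q =
    (1 - t) * (orient u w p * orient u w x) + t * (orient u w p * orient u w y)"
    unfolding t(3) by (simp add: algebra_simps)
  also have "\<dots> \<ge> 0"
    using t assms(6,7) by (simp add: sep_def)
  finally have "0 \<le> orient u w p * orient u w q" .
  also have "\<dots> = (1 - \<alpha>) * a + \<alpha> * b"
    unfolding assms(2) orient_affine a_def b_def by (simp add: algebra_simps)
  finally have 1: "\<alpha> * (a - b) \<le> a"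
    by (simp add: algebra_simps)
  have "0 = orient u w p * orient u w q'"
    using assms(4) by simp
  also have "\<dots> = (1 - \<beta>) * a + \<beta> * b"
    unfolding assms(3) orient_affine a_def b_def by (simp add: algebra_simps)
  finally have "\<beta> * (a - b) = a"
    by (simp add: algebra_simps)
  then have "\<alpha> * (a - b) \<le> \<beta> * (a - b)"
    using 1 by simp
  then show ?thesis
    using ab by simp
qed

lemma orient_on_line: "q \<in> open_segment u w \<Longrightarrow> orient u w q = 0"
  by (auto elim!: orient_open_segment)

text \<open>If no endpoint is behind the other arc, each arc is met no later than the other, so both
  are met at the same point. Then \<open>x\<close> and \<open>y\<close> lie on the line
  \<open>uw\<close> and the arcs coincide.\<close>

lemma two_crossings:
  assumes V: "u \<in> V" "w \<in> V" "x \<in> V" "y \<in> V" "z \<in> V"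
    and s: "sep u w p z" "sep x y p z" and ne: "closed_segment u w \<noteq> closed_segment x y"
  shows "sep u w p x \<or> sep u w p y \<or> sep x y p u \<or> sep x y p w"
proof (rule ccontr)
  assume no: "\<not> ?thesis"
  obtain q where q: "q \<in> open_segment x y" "q \<in> open_segment p z"
    using sep_imp_segments_meet[OF V(3,4) _ _ s(2)] V p_in_P V_in_P by metis
  obtain q' where q': "q' \<in> open_segment u w" "q' \<in> open_segment p z"
    using sep_imp_segments_meet[OF V(1,2) _ _ s(1)] V p_in_P V_in_P by metis
  obtain \<alpha> where \<alpha>: "q = (1 - \<alpha>) *\<^sub>R p + \<alpha> *\<^sub>R z"
    using q open_segmentE by metis
  obtain \<beta> where \<beta>: "q' = (1 - \<beta>) *\<^sub>R p + \<beta> *\<^sub>R z"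
    using q' open_segmentE by metis
  have "\<alpha> \<le> \<beta>"
    using first_crossing[OF q(1) \<alpha> \<beta> orient_on_line[OF q'(1)] s(1)] no by blast
  moreover have "\<beta> \<le> \<alpha>"
    using first_crossing[OF q'(1) \<beta> \<alpha> orient_on_line[OF q(1)] s(2)] no by blast
  ultimately have "orient u w q = 0"
    using \<alpha> \<beta> orient_on_line[OF q'(1)] by simp
  then have q0: "orient u w q * orient u w p = 0"
    by simp
  have sx: "orient u w x * orient u w p \<ge> 0" "orient u w y * orient u w p \<ge> 0"
    using no by (auto simp: sep_def mult.commute)
  have "orient u w x * orient u w p = 0"
    using open_segment_strict_side[OF q(1), of u w "orient u w p"] sx q0 by linarith
  moreover have "orient u w y * orient u w p = 0"
    using open_segment_strict_side[of q y x u w "orient u w p"] q(1) sx q0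
    by (metis open_segment_commute order_le_less order_less_irrefl)
  moreover have "orient u w p \<noteq> 0"
    using s by (auto simp: sep_def)
  ultimately have "orient u w x = 0" "orient u w y = 0"
    by simp_all
  then have "x \<in> {u, w}" "y \<in> {u, w}"
    using orient_vertices_nonzero V sep_distinct(1)[OF s(1)] by blast+
  then show False
    using ne sep_distinct(1)[OF s(2)] closed_segment_commute by auto
qed

text \<open>The flip towards the puncture is found by descent: of two arcs crossing the same segment
  from the puncture, one has an endpoint behind the other, and moving the target of the segment
  there keeps it crossed but loses an arc.\<close>

lemma singly_crossed_vertex:
  assumes "triangulation_of M T" "z \<in> V" "crossing_arcs T z \<noteq> {}"
  obtains v u w where "v \<in> V" "u \<in> V" "w \<in> V" "u \<noteq> w" "crossing_arcs T v = {closed_segment u w}"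
    "closed_segment u w \<in> crossing_arcs T z"
proof -
  \<comment> \<open>That \<open>e\<close> also crosses the original segment \<open>pz\<close> is
    carried through the induction because the degree bound relies on it.\<close>
  have "\<exists>v\<in>V. \<exists>e. crossing_arcs T v = {e} \<and> e \<in> crossing_arcs T z"
    using assms(2,3)
  proof (induction "card (crossing_arcs T z)" arbitrary: z rule: less_induct)
    case less
    obtain e where e: "e \<in> crossing_arcs T z"
      using less by blast
    show ?case
    proof (cases "crossing_arcs T z = {e}")
      case True
      then show ?thesis
        using less.prems by blast
    next
      case False
      then obtain g where g: "g \<in> crossing_arcs T z" "e \<noteq> g"
        using e by blast
      obtain u w where uw: "u \<in> V" "w \<in> V" "u \<noteq> w" "e = closed_segment u w" "e \<in> T" "sep u w p z"
        using crossing_arcsE[OF assms(1) less.prems(1) e] by metis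
      obtain x y where xy: "x \<in> V" "y \<in> V" "x \<noteq> y" "g = closed_segment x y" "g \<in> T" "sep x y p z"
        using crossing_arcsE[OF assms(1) less.prems(1) g(1)] by metis
      have uw': "closed_segment u w \<in> T" "closed_segment w u \<in> T" "sep w u p z"
        using uw sep_swap by (simp_all add: closed_segment_commute)
      have xy': "closed_segment x y \<in> T" "closed_segment y x \<in> T" "sep y x p z"
        using xy sep_swap by (simp_all add: closed_segment_commute)
      note smaller = crossing_arcs_psubset[OF assms(1) less.prems(1)]
      consider "sep u w p x" | "sep u w p y" | "sep x y p u" | "sep x y p w"
        using two_crossings[OF uw(1,2) xy(1,2) less.prems(1) uw(6) xy(6)] uw(4) xy(4) g(2) by blast
      then have "\<exists>x'\<in>V. crossing_arcs T x' \<noteq> {} \<and> crossing_arcs T x' \<subset> crossing_arcs T z"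
      proof cases
        case 1
        then show ?thesis
          using smaller[OF uw(1,2) xy(1-3) uw'(1) xy'(1) xy(6)] xy(1) by blast
      next
        case 2
        then show ?thesis
          using smaller[OF uw(1,2) xy(2,1) xy(3)[symmetric] uw'(1) xy'(2,3)] xy(2) by blast
      next
        case 3
        then show ?thesis
          using smaller[OF xy(1,2) uw(1-3) xy'(1) uw'(1) uw(6)] uw(1) by blast
      next
        case 4
        then show ?thesis
          using smaller[OF xy(1,2) uw(2,1) uw(3)[symmetric] xy'(1) uw'(2,3)] uw(2) by blast
      qed
      then obtain x' where x': "x' \<in> V" "crossing_arcs T x' \<noteq> {}"
        "crossing_arcs T x' \<subset> crossing_arcs T z"
        by blast
      then have "card (crossing_arcs T x') < card (crossing_arcs T z)"
        using psubset_card_mono finite_crossing_arcs assms(1) by blast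
      then show ?thesis
        using less.hyps[OF _ x'(1,2)] x'(3) by blast
    qed
  qed
  then obtain v e where v: "v \<in> V" "crossing_arcs T v = {e}" "e \<in> crossing_arcs T z"
    by blast
  then obtain u w where "u \<in> V" "w \<in> V" "u \<noteq> w" "e = closed_segment u w"
    using crossing_arcsE[OF assms(1) v(1), of e] by (metis singletonI)
  then show ?thesis
    using that v by metis
qed

text \<open>An arc separating \<open>p\<close> from \<open>u\<close> cannot cross \<open>uw\<close>,
  hence it also separates \<open>p\<close> from \<open>z\<close>. So it is \<open>uw\<close> itself,
  which ends at \<open>u\<close>.\<close>

lemma flip_arc_sees_puncture:
  assumes T: "triangulation_of M T" and V: "z \<in> V" "u \<in> V" "w \<in> V" "u \<noteq> w"
    and cr: "crossing_arcs T z = {closed_segment u w}"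
  shows "closed_segment p u \<in> T"
proof (rule ccontr)
  assume "\<not> ?thesis"
  then obtain e where "e \<in> crossing_arcs T u"
    using crossing_arcs_empty_iff T V by blast
  then obtain x y where xy: "x \<in> V" "y \<in> V" "x \<noteq> y" "closed_segment x y \<in> T" "sep x y p u"
    using crossing_arcsE[OF T V(2)] by metis
  have uw: "closed_segment u w \<in> T" "sep u w p z"
    using cr mem_crossing_arcs[of T z u w] T V by auto
  have "\<not> sep x y u w"
    using arcs_not_sep[of T x y u w] T V xy uw by auto
  then have "sep x y p z"
    using sep_through_arc V xy uw by blast
  then have "closed_segment x y = closed_segment u w"
    using cr mem_crossing_arcs[of T z x y] T V xy by auto
  then have "{x, y} = {u, w}"
    by simp
  then show False
    using sep_distinct(5,6)[OF xy(5)] by blast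
qed

text \<open>Suppose an arc of \<open>T\<close> crosses \<open>zu\<close>. If it joins two vertices,
  it cannot cross \<open>pu\<close>, so it crosses \<open>pz\<close> and is \<open>uw\<close>, which
  is absurd. If it is \<open>pv\<close>, it cannot cross \<open>uw\<close>, and then the vertex
  \<open>u\<close> lies inside the triangle \<open>v z w\<close>.\<close>

lemma flip_arc_sees_far_vertex:
  assumes T: "triangulation_of M T" and V: "z \<in> V" "u \<in> V" "w \<in> V" "u \<noteq> w"
    and cr: "crossing_arcs T z = {closed_segment u w}"
  shows "closed_segment z u \<in> T"
proof (rule ccontr)
  assume notin: "\<not> ?thesis"
  have uw: "closed_segment u w \<in> T" "sep u w p z"
    using cr mem_crossing_arcs[of T z u w] T V by auto
  note dist = sep_distinct[OF uw(2)]
  have pu: "closed_segment p u \<in> T"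
    using flip_arc_sees_puncture assms by blast
  obtain q where q: "q \<in> open_segment u w" "q \<in> open_segment p z"
    using sep_imp_segments_meet uw V p_in_P V_in_P by metis
  obtain t where t: "0 < t" "\<And>a b. orient a b q = (1 - t) * orient a b u + t * orient a b w"
    using orient_open_segment[OF q(1)] by metis
  obtain s where s: "s < 1" "\<And>a b. orient a b q = (1 - s) * orient a b p + s * orient a b z"
    using orient_open_segment[OF q(2)] by metis
  \<comment> \<open>Evaluating \<open>orient z u\<close> at the crossing point along both segments
    shows that \<open>p\<close> and \<open>w\<close> are on the same side of
    \<open>zu\<close>.\<close>
  have st: "(1 - s) * orient z u p = t * orient z u w"
    using s(2)[of z u] t(2)[of z u] by simp
  have w_nz: "orient z u w \<noteq> 0"
    using orient_vertices_nonzero[of z u w] V dist by auto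
  then have p_nz: "orient z u p \<noteq> 0"
    using st t(1) by auto
  show False
    using notin
  proof (cases rule: missing_vertex_arc[OF T V(1,2) p_nz, consumes 1, case_names vertices puncture])
    case (vertices h k)
    have hk: "h \<noteq> k"
      using sep_distinct[OF vertices(4)] by blast
    then have hkp: "orient h k p \<noteq> 0"
      using arc_endpoints_nonzero T vertices by blast
    have "crosses (closed_segment z u) (closed_segment h k)"
      using crosses_vertex_arc_iff[of z u h k] V vertices p_nz hk by auto
    then have "sep h k z u"
      using crosses_vertex_arc_iff[of h k z u] V vertices hkp dist crosses_commute by auto
    moreover have "\<not> sep h k p u"
      using arcs_not_sep[of T h k p u] T V vertices hk pu p_notin_V by auto
    ultimately have "sep h k p z"
      using hkp by (auto simp: sep_def mult_less_0_iff)
    then have "closed_segment h k = closed_segment u w"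
      using cr mem_crossing_arcs[of T z h k] T V vertices hk by auto
    then have "{h, k} = {u, w}"
      by simp
    then show False
      using sep_distinct(5,6)[OF \<open>sep h k z u\<close>] by blast
  next
    case (puncture v)
    have "\<not> sep u w p v"
      using arcs_not_sep[of T u w p v] T V uw puncture p_notin_V by auto
    define \<sigma> where "\<sigma> = orient z u w"
    have "orient z u p * \<sigma> > 0"
    proof -
      have "(1 - s) * (orient z u p * \<sigma>) = t * (\<sigma> * \<sigma>)"
        using st by (simp add: \<sigma>_def)
      also have "\<dots> > 0"
        using t(1) w_nz by (auto simp: \<sigma>_def zero_less_mult_iff linorder_neq_iff)
      finally show ?thesis
        using s(1) by (simp add: zero_less_mult_iff)
    qed
    then have v1: "orient z u v * \<sigma> < 0"
      using puncture(3) by (auto simp: sep_def mult_less_0_iff zero_less_mult_iff)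
    then have "v \<noteq> w"
      by (auto simp: \<sigma>_def not_less)
    then have "orient u w v \<noteq> 0"
      using orient_vertices_nonzero[of u w v] V puncture dist sep_distinct[OF puncture(3)] by auto
    moreover have "orient u w z = \<sigma>"
      by (simp add: \<sigma>_def orient_rotate)
    ultimately have v2: "orient u w v * \<sigma> < 0"
      using uw(2) \<open>\<not> sep u w p v\<close> by (auto simp: sep_def mult_less_0_iff not_less zero_le_mult_iff)
    have eqs: "orient v z u = orient z u v" "orient z w u = - \<sigma>" "orient w v u = orient u w v"
      by (simp_all add: \<sigma>_def orient_def algebra_simps)
    have "\<sigma> * \<sigma> > 0"
      using w_nz by (auto simp: \<sigma>_def zero_less_mult_iff linorder_neq_iff)
    then have "orient v z u * - \<sigma> > 0" "orient z w u * - \<sigma> > 0" "orient w v u * - \<sigma> > 0"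
      unfolding eqs using v1 v2 by simp_all
    then show False
      using vertex_not_in_triangle[of u v z w "- \<sigma>"] V puncture V_in_P by blast
  qed
qed

text \<open>Seen from \<open>a\<close>, both \<open>v\<close> and \<open>t\<close> are on one side
  of \<open>ab\<close>. The one whose direction is closer to that of \<open>b\<close> spans a line
  through \<open>a\<close> that separates \<open>b\<close> from the other.\<close>

lemma quadrilateral_diagonals_cross:
  assumes "a \<in> V" "b \<in> V" "v \<in> V" "t \<in> V" "a \<noteq> b" "v \<noteq> t" "orient a b v * orient a b t > 0"
  shows "sep a v b t \<or> sep a t b v"
proof -
  have dist: "v \<noteq> a" "v \<noteq> b" "t \<noteq> a" "t \<noteq> b"
    using assms(7) by auto
  have "orient a v t \<noteq> 0"
    using orient_vertices_nonzero[of a v t] assms dist by auto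
  moreover have "orient a v b = - orient a b v" "orient a t b = - orient a b t"
    "orient a t v = - orient a v t"
    by (simp_all add: orient_def algebra_simps)
  ultimately show ?thesis
    using assms(7) unfolding sep_def by (auto simp: mult_less_0_iff zero_less_mult_iff linorder_neq_iff)
qed

text \<open>The only arc crossing \<open>pz\<close> is removed. For maximality, an arc that could
  still be added crosses only \<open>uw\<close> in \<open>T\<close>. If it is \<open>pv\<close>,
  then \<open>z\<close> and \<open>v\<close> are both joined to \<open>u\<close> and
  \<open>w\<close> on the far side of \<open>uw\<close>, and two of these arcs cross. If it joins
  two vertices, it separates \<open>u\<close> from \<open>w\<close> and so crosses \<open>pu\<close>
  or \<open>pw\<close>.\<close>

lemma triangulation_flip_towards_puncture:
  assumes T: "triangulation_of M T" and V: "z \<in> V" "u \<in> V" "w \<in> V" "u \<noteq> w"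
    and cr: "crossing_arcs T z = {closed_segment u w}"
  shows "triangulation_of M (insert (closed_segment p z) (T - {closed_segment u w}))"
    (is "triangulation_of M ?T'")
proof -
  have uw: "closed_segment u w \<in> T" "sep u w p z" "crosses (closed_segment u w) (closed_segment p z)"
    using cr mem_crossing_arcs[of T z u w] T V by (auto simp: crossing_arcs_def)
  have nz: "orient u w p \<noteq> 0"
    using uw by (auto simp: sep_def)
  have cr': "crossing_arcs T z = {closed_segment w u}"
    using cr by (simp add: closed_segment_commute)
  have see: "closed_segment p u \<in> ?T'" "closed_segment p w \<in> ?T'"
    using flip_arc_sees_puncture[OF T V cr] flip_arc_sees_puncture[OF T V(1,3,2) V(4)[symmetric] cr']
      V p_notin_V by (auto simp: doubleton_eq_iff)
  have "noncrossing_arc_set M ?T'"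
    unfolding noncrossing_arc_set_iff
  proof (intro conjI ballI)
    show "?T' \<subseteq> segment_arcs M"
      using T puncture_arc[OF V(1)] by (auto simp: triangulation_of_iff noncrossing_arc_set_iff)
    have *: "\<not> crosses e (closed_segment p z)" if "e \<in> T - {closed_segment u w}" for e
      using that cr by (auto simp: crossing_arcs_def)
    fix e f assume "e \<in> ?T'" "f \<in> ?T'"
    moreover have "\<not> crosses (closed_segment p z) (closed_segment p z)"
      by (simp add: crosses_def)
    moreover have "\<forall>e\<in>T. \<forall>f\<in>T. \<not> crosses e f"
      using T by (simp add: triangulation_of_iff noncrossing_arc_set_iff)
    ultimately show "\<not> crosses e f"
      using * crosses_commute by blast
  qed
  moreover have "e \<in> ?T'" if e: "e \<in> segment_arcs M" "\<forall>f\<in>?T'. \<not> crosses e f" for e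
  proof (rule ccontr)
    assume notin: "e \<notin> ?T'"
    have "e \<noteq> closed_segment u w"
      using e(2) uw(3) by auto
    then have "e \<notin> T"
      using notin by auto
    then obtain f where f: "f \<in> T" "crosses e f"
      using T e(1) by (auto simp: triangulation_of_iff)
    then have "f = closed_segment u w"
      using e(2) by auto
    then have ce: "crosses e (closed_segment u w)"
      using f by simp
    show False
      using e(1)
    proof (cases rule: arc_cases)
      case (puncture v)
      have vz: "v \<noteq> z"
        using notin puncture by auto
      have "crossing_arcs T v = {closed_segment u w}"
        using ce uw(1) e(2) puncture crosses_commute by (auto simp: crossing_arcs_def)
      then have cv: "crossing_arcs T v = {closed_segment u w}" "crossing_arcs T v = {closed_segment w u}"
        by (simp_all add: closed_segment_commute)
      have far: "closed_segment u z \<in> T" "closed_segment w z \<in> T"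
        "closed_segment u v \<in> T" "closed_segment w v \<in> T"
        using flip_arc_sees_far_vertex[OF T V cr] flip_arc_sees_far_vertex[OF T V(1,3,2) V(4)[symmetric] cr']
          flip_arc_sees_far_vertex[OF T puncture(1) V(2-4) cv(1)]
          flip_arc_sees_far_vertex[OF T puncture(1) V(3,2) V(4)[symmetric] cv(2)]
        by (simp_all add: closed_segment_commute)
      have sv: "sep u w p v"
        using mem_crossing_arcs[of T v u w] T V puncture cv by auto
      then have "orient u w z * orient u w v > 0"
        using uw(2) by (auto simp: sep_def mult_less_0_iff zero_less_mult_iff)
      then have "sep u z w v \<or> sep u v w z"
        using quadrilateral_diagonals_cross V puncture vz by auto
      then show False
        using arcs_not_sep[of T u z w v] arcs_not_sep[of T u v w z] T V puncture far
          sep_distinct[OF sv] sep_distinct[OF uw(2)] by auto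
    next
      case (vertices x y)
      have "sep x y u w"
        using crosses_vertex_arc_iff[of x y u w] vertices V ce by auto
      moreover have "\<not> crosses e (closed_segment p u)" "\<not> crosses e (closed_segment p w)"
        using e(2) see by blast+
      then have "\<not> sep x y p u" "\<not> sep x y p w"
        using crosses_vertex_arc_iff[of x y p u] crosses_vertex_arc_iff[of x y p w]
          vertices V p_notin_V by auto
      ultimately show False
        using vertices(4) by (auto simp: sep_def mult_less_0_iff)
    qed
  qed
  ultimately show ?thesis
    by (simp add: triangulation_of_iff)
qed

section \<open>The degree of the puncture and the upper bound\<close>

definition puncture_nbrs :: "(real^2) set set \<Rightarrow> (real^2) set" where
  "puncture_nbrs T = {v \<in> V. closed_segment p v \<in> T}"

lemma flip_increases_degree:
  assumes T: "triangulation_of M T" and "puncture_nbrs T \<noteq> V"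
  obtains T' z where "triangulation_of M T'" "differ_by_one_arc T T'" "z \<in> V" "z \<notin> puncture_nbrs T"
    "puncture_nbrs T' = insert z (puncture_nbrs T)"
proof -
  obtain z0 where z0: "z0 \<in> V" "closed_segment p z0 \<notin> T"
    using assms by (auto simp: puncture_nbrs_def)
  then have "crossing_arcs T z0 \<noteq> {}"
    using crossing_arcs_empty_iff T by blast
  then obtain z u w where z: "z \<in> V" "u \<in> V" "w \<in> V" "u \<noteq> w"
    "crossing_arcs T z = {closed_segment u w}"
    using singly_crossed_vertex[OF T z0(1)] by metis
  let ?T' = "insert (closed_segment p z) (T - {closed_segment u w})"
  have pz: "closed_segment p z \<notin> T"
    using crossing_arcs_empty_iff[OF T z(1)] z(5) by auto
  have uw: "closed_segment u w \<in> T"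
    using z(5) by (auto simp: crossing_arcs_def)
  have ne: "closed_segment p v \<noteq> closed_segment u w" for v
    using z p_notin_V by (auto simp: doubleton_eq_iff)
  have "T - ?T' = {closed_segment u w}" "?T' - T = {closed_segment p z}"
    using pz uw ne[of z] by auto
  then have "differ_by_one_arc T ?T'"
    by (simp add: differ_by_one_arc_def)
  moreover have "puncture_nbrs ?T' = insert z (puncture_nbrs T)"
    using z(1) ne p_notin_V by (auto simp: puncture_nbrs_def doubleton_eq_iff)
  moreover have "z \<notin> puncture_nbrs T"
    using pz by (simp add: puncture_nbrs_def)
  ultimately show ?thesis
    using that triangulation_flip_towards_puncture[OF T z] z(1) by blast
qed

text \<open>Otherwise a closed half-plane missing \<open>p\<close> would contain all vertices and
  hence their hull \<open>P\<close>.\<close>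

lemma vertex_on_puncture_side:
  assumes "orient u w p * s > 0"
  obtains y where "y \<in> V" "orient u w y * s > 0"
proof (rule ccontr)
  assume no: "\<not> thesis"
  have "convex {x. orient u w x * s \<le> 0}"
    unfolding convex_alt
  proof (intro ballI allI impI)
    fix x y :: "real^2" and t :: real
    assume xy: "x \<in> {x. orient u w x * s \<le> 0}" "y \<in> {x. orient u w x * s \<le> 0}" "0 \<le> t \<and> t \<le> 1"
    have "orient u w ((1 - t) *\<^sub>R x + t *\<^sub>R y) * s =
      (1 - t) * (orient u w x * s) + t * (orient u w y * s)"
      unfolding orient_affine by (simp add: algebra_simps)
    also have "\<dots> \<le> 0"
      using xy by (intro add_nonpos_nonpos mult_nonneg_nonpos[of "1 - t"] mult_nonneg_nonpos[of t]) auto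
    finally show "(1 - t) *\<^sub>R x + t *\<^sub>R y \<in> {x. orient u w x * s \<le> 0}"
      by simp
  qed
  moreover have "V \<subseteq> {x. orient u w x * s \<le> 0}"
    using no that by force
  ultimately have "P \<subseteq> {x. orient u w x * s \<le> 0}"
    unfolding P_hull by (rule hull_minimal[rotated])
  then show False
    using assms p_in_P by auto
qed

lemma three_le_card:
  assumes "finite A" "x \<in> A" "y \<in> A" "z \<in> A" "x \<noteq> y" "x \<noteq> z" "y \<noteq> z"
  shows "3 \<le> card A"
proof -
  have "card {x, y, z} \<le> card A"
    using assms by (intro card_mono) auto
  then show ?thesis
    using assms by simp
qed

text \<open>A vertex seen across a single arc \<open>uw\<close> yields the neighbours
  \<open>u\<close> and \<open>w\<close>. A vertex \<open>y\<close> on the puncture's side of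
  \<open>uw\<close> is a third one, or else \<open>py\<close> is crossed by an arc whose endpoints
  are neighbours too. That arc is not \<open>uw\<close>, so one of its endpoints is new.\<close>

lemma puncture_degree_ge_3:
  assumes T: "triangulation_of M T" and "3 \<le> card V"
  shows "3 \<le> card (puncture_nbrs T)"
proof (cases "puncture_nbrs T = V")
  case True
  then show ?thesis
    using assms by simp
next
  case False
  have fin: "finite (puncture_nbrs T)"
    using finite_V by (simp add: puncture_nbrs_def)
  have ends: "x \<in> puncture_nbrs T" "y \<in> puncture_nbrs T"
    if "v \<in> V" "x \<in> V" "y \<in> V" "x \<noteq> y" "crossing_arcs T v = {closed_segment x y}" for v x y
    using flip_arc_sees_puncture[OF T that] that closed_segment_commute[of x y]
      flip_arc_sees_puncture[OF T that(1,3,2) that(4)[symmetric]]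
    by (simp_all add: puncture_nbrs_def)
  obtain z0 where z0: "z0 \<in> V" "crossing_arcs T z0 \<noteq> {}"
    using False crossing_arcs_empty_iff[OF T] by (auto simp: puncture_nbrs_def)
  obtain z u w where z: "z \<in> V" "u \<in> V" "w \<in> V" "u \<noteq> w" "crossing_arcs T z = {closed_segment u w}"
    using singly_crossed_vertex[OF T z0] by metis
  have "sep u w p z"
    using mem_crossing_arcs[of T z u w] T z by auto
  then have "orient u w p * orient u w p > 0"
    by (auto simp: sep_def zero_less_mult_iff mult_less_0_iff)
  then obtain y where y: "y \<in> V" "orient u w y * orient u w p > 0"
    using vertex_on_puncture_side by metis
  then have ne: "y \<noteq> u" "y \<noteq> w"
    by auto
  show ?thesis
  proof (cases "y \<in> puncture_nbrs T")
    case True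
    then show ?thesis
      using three_le_card[OF fin, of u w y] ends[OF z] z(4) ne by auto
  next
    case False
    then have "crossing_arcs T y \<noteq> {}"
      using crossing_arcs_empty_iff[OF T y(1)] y(1) by (simp add: puncture_nbrs_def)
    then obtain z' u' w' where z': "z' \<in> V" "u' \<in> V" "w' \<in> V" "u' \<noteq> w'"
      "crossing_arcs T z' = {closed_segment u' w'}" "closed_segment u' w' \<in> crossing_arcs T y"
      using singly_crossed_vertex[OF T y(1)] by metis
    have "\<not> sep u w p y"
      using y(2) by (simp add: sep_def mult.commute)
    then have "closed_segment u w \<noteq> closed_segment u' w'"
      using z'(6) mem_crossing_arcs[OF T y(1) z(2-4)] by metis
    then have "{u, w} \<noteq> {u', w'}"
      by simp
    then obtain t where t: "t \<in> {u', w'}" "t \<noteq> u" "t \<noteq> w"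
      using z'(4) by blast
    then have "t \<in> puncture_nbrs T"
      using ends[OF z'(1-5)] by blast
    then show ?thesis
      using three_le_card[OF fin ends[OF z]] z(4) t by metis
  qed
qed

text \<open>Since all arcs \<open>pv\<close> are in \<open>T\<close>, an arc \<open>uw\<close> of
  \<open>T\<close> has every vertex weakly on the side of \<open>p\<close>. Any arc crossing it
  would have a vertex strictly on the other side. The inclusion suffices by symmetry.\<close>

lemma full_degree_unique:
  assumes T: "triangulation_of M T" "puncture_nbrs T = V"
    and T': "triangulation_of M T'" "puncture_nbrs T' = V"
  shows "T \<subseteq> T'"
proof
  fix e assume e: "e \<in> T"
  have star: "closed_segment p v \<in> T" "closed_segment p v \<in> T'" if "v \<in> V" for v
    using that T T' by (auto simp: puncture_nbrs_def)
  have "e \<in> segment_arcs M"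
    using e T by (auto simp: triangulation_of_iff noncrossing_arc_set_iff)
  then show "e \<in> T'"
  proof (cases rule: arc_cases)
    case (puncture v)
    then show ?thesis
      using star by simp
  next
    case (vertices u w)
    have near: "\<not> sep u w p v" if "v \<in> V" for v
      using arcs_not_sep[of T u w p v] T vertices e star that p_notin_V by auto
    show ?thesis
    proof (rule ccontr)
      assume "e \<notin> T'"
      then have "closed_segment u w \<notin> T'"
        using vertices by simp
      then show False
      proof (cases rule: missing_vertex_arc[OF T'(1) vertices(1,2,4), consumes 1, case_names vs pt])
        case (vs h k)
        then show False
          using near[of h] near[of k] vertices(4) by (auto simp: sep_def mult_less_0_iff)
      next
        case (pt t)
        then show False
          using near by blast
      qed
    qed
  qed
qed

text \<open>Each flip adds exactly one neighbour of the puncture, so the number of flips is the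
  number of missing neighbours.\<close>

lemma center_reachable:
  assumes "triangulation_of M T"
  obtains T0 where "triangulation_of M T0" "puncture_nbrs T0 = V"
    "(T, T0) \<in> parcs (flip_graph M) ^^ (card V - card (puncture_nbrs T))"
proof -
  have "\<exists>T0. triangulation_of M T0 \<and> puncture_nbrs T0 = V \<and>
    (T, T0) \<in> parcs (flip_graph M) ^^ k"
    if "triangulation_of M T" "card V - card (puncture_nbrs T) = k" for T k
    using that
  proof (induction k arbitrary: T)
    case 0
    have sub: "puncture_nbrs T \<subseteq> V"
      by (auto simp: puncture_nbrs_def)
    then have "puncture_nbrs T = V"
      using 0 finite_V by (intro card_seteq) auto
    then show ?case
      using 0 by auto
  next
    case (Suc k)
    have fin: "finite (puncture_nbrs T)"
      using finite_V by (simp add: puncture_nbrs_def)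
    have "puncture_nbrs T \<noteq> V"
      using Suc.prems by auto
    then obtain T' z where T': "triangulation_of M T'" "differ_by_one_arc T T'"
      "z \<notin> puncture_nbrs T" "puncture_nbrs T' = insert z (puncture_nbrs T)"
      using flip_increases_degree[OF Suc.prems(1)] by metis
    then have "card V - card (puncture_nbrs T') = k"
      using Suc.prems fin by simp
    then obtain T0 where "triangulation_of M T0" "puncture_nbrs T0 = V"
      "(T', T0) \<in> parcs (flip_graph M) ^^ k"
      using Suc.IH T'(1) by blast
    moreover have "(T, T') \<in> parcs (flip_graph M)"
      using Suc.prems T' by (simp add: flip_graph_def)
    ultimately show ?case
      by (metis relpow_Suc_I2)
  qed
  then show ?thesis
    using that assms by blast
qed

lemma flip_graph_diam_le:
  assumes "3 \<le> card V"
  shows "graph_diam (flip_graph M) \<le> ereal (2 * real (card V) - 6)"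
  unfolding graph_diam_def
proof (rule SUP_least, clarify)
  fix T T' assume T: "T \<in> pverts (flip_graph M)" "T' \<in> pverts (flip_graph M)"
  then have tri: "triangulation_of M T" "triangulation_of M T'"
    by (simp_all add: flip_graph_def)
  let ?k = "card V - card (puncture_nbrs T)" and ?k' = "card V - card (puncture_nbrs T')"
  obtain T0 where T0: "triangulation_of M T0" "puncture_nbrs T0 = V"
    "(T, T0) \<in> parcs (flip_graph M) ^^ ?k"
    using center_reachable[OF tri(1)] by metis
  obtain T1 where T1: "triangulation_of M T1" "puncture_nbrs T1 = V"
    "(T', T1) \<in> parcs (flip_graph M) ^^ ?k'"
    using center_reachable[OF tri(2)] by metis
  have "T1 = T0"
    using full_degree_unique T0 T1 by (meson subset_antisym)
  moreover have "sym (parcs (flip_graph M))"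
    by (auto simp: sym_def flip_graph_def differ_by_one_arc_def)
  ultimately have "(T0, T') \<in> parcs (flip_graph M) ^^ ?k'"
    using T1(3) relpow_sym by metis
  then have "(T, T') \<in> parcs (flip_graph M) ^^ (?k + ?k')"
    using T0(3) by (auto simp: relpow_add)
  then have "graph_dist (flip_graph M) T T' \<le> ereal (real (?k + ?k'))"
    by (rule graph_dist_le_relpow[OF pair_wf_digraph_flip_graph T(1)])
  also have "real (?k + ?k') \<le> 2 * real (card V) - 6"
    using puncture_degree_ge_3[OF tri(1) assms] puncture_degree_ge_3[OF tri(2) assms] assms by linarith
  finally show "graph_dist (flip_graph M) T T' \<le> ereal (2 * real (card V) - 6)"
    by simp
qed

end

section \<open>A pair of distant triangulations\<close>

text \<open>The form in which closeness to the edge is used: for every other vertex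
  \<open>v\<close>, the puncture is on the same side of the chord \<open>av\<close> as
  \<open>b\<close>, and on the same side of the chord \<open>bv\<close> as \<open>a\<close>.\<close>

locale puncture_near_edge = punctured_polygon +
  fixes a b
  assumes a_in_V: "a \<in> V" and b_in_V: "b \<in> V" and a_neq_b: "a \<noteq> b"
    and edge: "v \<in> V - {a, b} \<Longrightarrow> orient a b v > 0"
    and near_edge: "v \<in> V - {a, b} \<Longrightarrow> orient a p v > 0 \<and> orient p b v > 0"
begin

abbreviation "W \<equiv> V - {a, b}"

text \<open>The quadrilateral with opposite sides \<open>ab\<close> and \<open>vu\<close> contains the puncture, so its diagonals
  \<open>av\<close> and \<open>bu\<close> are never exchanged by a flip.\<close>

lemma no_flip_between_fans:
  assumes T: "triangulation_of M T" and T': "triangulation_of M T'" and V3: "3 \<le> card V"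
    and v: "v \<in> W" "T - T' = {closed_segment a v}"
    and u: "u \<in> W" "T' - T = {closed_segment b u}"
  shows False
proof -
  have VV: "a \<in> V" "b \<in> V" "v \<in> V" "u \<in> V" "a \<noteq> v" "b \<noteq> u" "a \<noteq> u" "b \<noteq> v" "a \<noteq> p" "b \<noteq> p"
    using v u a_in_V b_in_V p_notin_V by auto
  have p_side: "orient a v p < 0" "orient b u p > 0"
    using near_edge[OF v(1)] near_edge[OF u(1)] by (simp_all add: orient_def algebra_simps)
  have av: "closed_segment a v \<in> T" and bu: "closed_segment b u \<in> T'" "closed_segment b u \<notin> T"
    using v u by auto
  have "closed_segment b u \<in> segment_arcs M"
    using bu T' by (auto simp: triangulation_of_iff noncrossing_arc_set_iff)
  \<comment> \<open>Some arc of \<open>T\<close> crosses \<open>bu\<close>. It cannot survive in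
    \<open>T'\<close>, so it is the removed arc \<open>av\<close>.\<close>
  then obtain f where f: "f \<in> T" "crosses (closed_segment b u) f"
    using bu T by (auto simp: triangulation_of_iff)
  then have "f \<notin> T'"
    using bu T' by (auto simp: triangulation_of_iff noncrossing_arc_set_iff)
  then have cr: "crosses (closed_segment b u) (closed_segment a v)"
    using f v(2) by (metis DiffI singletonD)
  then have s1: "sep b u a v"
    using crosses_vertex_arc_iff[of b u a v] VV p_side by auto
  have s2: "sep a v b u"
    using cr crosses_vertex_arc_iff[of a v b u] VV p_side crosses_commute by auto
  have "orient b u a = orient a b u" "orient a v b = - orient a b v"
    by (simp_all add: orient_def algebra_simps)
  then have sides: "orient b u v < 0" "orient a v u > 0"
    using s1 s2 edge[OF v(1)] edge[OF u(1)]
    by (auto simp: sep_def mult_less_0_iff zero_less_mult_iff)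
  have "\<not> puncture_nbrs T \<subseteq> {a, b}"
  proof
    assume "puncture_nbrs T \<subseteq> {a, b}"
    then have "card (puncture_nbrs T) \<le> card {a, b}"
      by (intro card_mono) auto
    then show False
      using puncture_degree_ge_3[OF T V3] a_neq_b by simp
  qed
  \<comment> \<open>A third neighbour of the puncture, whose arc is not the one removed and
    therefore belongs to both triangulations.\<close>
  then obtain t where t: "t \<in> W" "closed_segment p t \<in> T"
    by (auto simp: puncture_nbrs_def)
  then have tV: "t \<in> V" "t \<noteq> a" "t \<noteq> b" "t \<noteq> p"
    using p_notin_V by auto
  have "closed_segment p t \<noteq> closed_segment a v"
    using VV tV by (auto simp: doubleton_eq_iff)
  then have t': "closed_segment p t \<in> T'"
    using t(2) v(2) by blast
  have n1: "\<not> sep a v p t"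
    using arcs_not_sep[OF T, of a v p t] VV av t(2) tV by auto
  have n2: "\<not> sep b u p t"
    using arcs_not_sep[OF T', of b u p t] VV bu t' tV by auto
  have "t \<noteq> u" "t \<noteq> v"
    using n1 n2 p_side sides by (auto simp: sep_def mult_less_0_iff)
  then have "orient a v t \<noteq> 0" "orient b u t \<noteq> 0"
    using orient_vertices_nonzero VV tV by auto
  then have ts: "orient a v t < 0" "orient b u t > 0"
    using n1 n2 p_side by (auto simp: sep_def mult_less_0_iff)
  \<comment> \<open>The diagonals meet in \<open>x\<close>, and the vertex \<open>t\<close>, being
    on the puncture's side of both, lies inside the triangle \<open>a b x\<close>.\<close>
  obtain x where x: "x \<in> open_segment a v" "x \<in> open_segment b u"
    using sep_imp_segments_meet[OF VV(1,3) _ _ s2] VV V_in_P by metis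
  then have "x \<in> P"
    using convex_P VV V_in_P by (metis convex_contains_open_segment subsetD)
  obtain \<alpha> where \<alpha>: "0 < \<alpha>" "orient t a x = (1 - \<alpha>) * orient t a a + \<alpha> * orient t a v"
    using orient_open_segment[OF x(1)] by metis
  obtain \<beta> where \<beta>: "0 < \<beta>" "orient t b x = (1 - \<beta>) * orient t b b + \<beta> * orient t b u"
    using orient_open_segment[OF x(2)] by metis
  have "orient x a t = - (\<alpha> * orient a v t)" "orient b x t = \<beta> * orient b u t"
    using \<alpha>(2) \<beta>(2) orient_rotate[of b x t] orient_rotate[of b u t] orient_rotate[of a x t]
      orient_rotate[of a v t] orient_swap[of a x t]
    by simp_all
  then have "orient x a t > 0" "orient b x t > 0"
    using ts \<alpha>(1) \<beta>(1) by (simp_all add: mult_less_0_iff)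
  then show False
    using vertex_not_in_triangle[of t a b x 1] edge[OF t(1)] tV VV \<open>x \<in> P\<close> V_in_P by auto
qed

lemma fan_extends:
  assumes "c \<in> {a, b}"
  obtains T where "triangulation_of M T" "\<And>v. v \<in> W \<Longrightarrow> closed_segment c v \<in> T"
proof -
  have c: "c \<in> V" "\<And>v. v \<in> W \<Longrightarrow> c \<noteq> v"
    using assms a_in_V b_in_V by auto
  have nz: "orient c v p \<noteq> 0" if "v \<in> W" for v
  proof -
    have "orient a v p = - orient a p v" "orient b v p = orient p b v"
      by (simp_all add: orient_def algebra_simps)
    then show ?thesis
      using assms near_edge[OF that] by auto
  qed
  have "noncrossing_arc_set M ((\<lambda>v. closed_segment c v) ` W)"
    unfolding noncrossing_arc_set_iff
  proof (intro conjI ballI)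
    show "(\<lambda>v. closed_segment c v) ` W \<subseteq> segment_arcs M"
      using vertex_arc_iff c nz by auto
    fix e f assume "e \<in> (\<lambda>v. closed_segment c v) ` W" "f \<in> (\<lambda>v. closed_segment c v) ` W"
    then obtain v t where vt: "v \<in> W" "t \<in> W" "e = closed_segment c v" "f = closed_segment c t"
      by auto
    then show "\<not> crosses e f"
      using crosses_vertex_arc_iff[of c v c t] nz c by (auto simp: sep_def)
  qed
  then show ?thesis
    using noncrossing_arc_set_extends[of M] finite_V that by (metis finite_insert image_subset_iff)
qed

text \<open>Of any two fan arcs from \<open>c\<close>, one crosses an arc from \<open>d\<close>, by
  \<open>quadrilateral_diagonals_cross\<close>. Hence at most one of the \<open>card V - 2\<close>
  arcs is not counted; geometrically it is the boundary edge at \<open>c\<close> other than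
  \<open>ab\<close>.\<close>

lemma card_crossing_fan:
  assumes "c \<in> V" "d \<in> V" "c \<noteq> d" "{c, d} = {a, b}"
  shows "card V - 3 \<le> card ((\<lambda>v. closed_segment c v) ` {v \<in> W. \<exists>u\<in>W. sep c v d u})"
proof -
  let ?A = "{v \<in> W. \<exists>u\<in>W. sep c v d u}"
  have inj: "inj_on (\<lambda>v. closed_segment c v) ?A"
    using assms(4) by (auto simp: inj_on_def doubleton_eq_iff)
  have same_side: "orient c d v * orient c d t > 0" if "v \<in> W" "t \<in> W" for v t
    using edge[OF that(1)] edge[OF that(2)] assms(4) orient_swap[of a b]
    by (auto simp: doubleton_eq_iff zero_less_mult_iff)
  have "x = y" if "x \<in> W - ?A" "y \<in> W - ?A" for x y
    using quadrilateral_diagonals_cross[of c d x y] same_side[of x y] that assms(1-3) by auto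
  then have "card (W - ?A) \<le> Suc 0"
    using finite_V by (simp only: card_le_Suc0_iff_eq finite_Diff) blast
  moreover have "card W = card V - 2"
    using finite_V a_in_V b_in_V a_neq_b by (subst card_Diff_subset) auto
  moreover have "card (W - ?A) = card W - card ?A"
    using finite_V by (intro card_Diff_subset) auto
  moreover have "card ((\<lambda>v. closed_segment c v) ` ?A) = card ?A"
    using inj by (rule card_image)
  ultimately show ?thesis
    by linarith
qed

lemma flip_graph_diam_ge:
  assumes V3: "3 \<le> card V"
  shows "graph_diam (flip_graph M) \<ge> ereal (2 * real (card V) - 6)"
proof -
  \<comment> \<open>Keeping only arcs crossed by the opposite fan ensures that \<open>A\<close> is
    disjoint from \<open>T2\<close> and \<open>B\<close> from \<open>T1\<close>.\<close>
  define A where "A = (\<lambda>v. closed_segment a v) ` {v \<in> W. \<exists>u\<in>W. sep a v b u}"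
  define B where "B = (\<lambda>u. closed_segment b u) ` {u \<in> W. \<exists>v\<in>W. sep b u a v}"
  have fin: "finite A" "finite B"
    using finite_V by (simp_all add: A_def B_def)
  obtain T1 where T1: "triangulation_of M T1" "\<And>v. v \<in> W \<Longrightarrow> closed_segment a v \<in> T1"
    using fan_extends[of a] by blast
  obtain T2 where T2: "triangulation_of M T2" "\<And>u. u \<in> W \<Longrightarrow> closed_segment b u \<in> T2"
    using fan_extends[of b] by blast
  have 1: "A \<subseteq> T1" "B \<inter> T1 = {}"
    using T1 arcs_not_sep[OF T1(1), of b _ a] a_in_V b_in_V by (auto simp: A_def B_def)
  have 2: "B \<subseteq> T2" "A \<inter> T2 = {}"
    using T2 arcs_not_sep[OF T2(1), of a _ b] a_in_V b_in_V by (auto simp: A_def B_def)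
  \<comment> \<open>Progress from \<open>T1\<close> to \<open>T2\<close>: arcs of \<open>A\<close>
    already removed plus arcs of \<open>B\<close> already inserted.\<close>
  define \<Phi> where "\<Phi> T = real (card (A - T) + card (B \<inter> T))" for T
  have step: "\<Phi> T' \<le> \<Phi> T + 1" if "(T, T') \<in> parcs (flip_graph M)" for T T'
  proof -
    have tri: "triangulation_of M T" "triangulation_of M T'"
      using that by (simp_all add: flip_graph_def)
    have "card (T - T') = 1" "card (T' - T) = 1"
      using that by (simp_all add: flip_graph_def differ_by_one_arc_def)
    then obtain e f where e: "T - T' = {e}" and f: "T' - T = {f}"
      by (meson card_1_singletonE)
    have e': "x = e" if "x \<in> T" "x \<notin> T'" for x
      using that e by (metis DiffI singletonD)
    have f': "x = f" if "x \<in> T'" "x \<notin> T" for x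
      using that f by (metis DiffI singletonD)
    \<comment> \<open>Only a flip exchanging an arc of \<open>A\<close> for one of \<open>B\<close>
      could raise \<open>\<Phi>\<close> by two.\<close>
    have "\<not> (e \<in> A \<and> f \<in> B)"
      using no_flip_between_fans[OF tri V3] e f by (auto simp: A_def B_def)
    then consider "e \<notin> A" | "f \<notin> B"
      by blast
    then show ?thesis
    proof cases
      case 1
      then have "A - T' \<subseteq> A - T" "B \<inter> T' \<subseteq> insert f (B \<inter> T)"
        using e' f' by auto
      then have "card (A - T') \<le> card (A - T)" "card (B \<inter> T') \<le> card (insert f (B \<inter> T))"
        using fin by (simp_all add: card_mono)
      moreover have "card (insert f (B \<inter> T)) \<le> Suc (card (B \<inter> T))"
        using fin by (simp add: card_insert_le_m1 card_insert_if)
      ultimately show ?thesis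
        by (simp add: \<Phi>_def)
    next
      case 2
      then have "A - T' \<subseteq> insert e (A - T)" "B \<inter> T' \<subseteq> B \<inter> T"
        using e' f' by auto
      then have "card (A - T') \<le> card (insert e (A - T))" "card (B \<inter> T') \<le> card (B \<inter> T)"
        using fin by (simp_all add: card_mono)
      moreover have "card (insert e (A - T)) \<le> Suc (card (A - T))"
        using fin by (simp add: card_insert_if)
      ultimately show ?thesis
        by (simp add: \<Phi>_def)
    qed
  qed
  have "\<Phi> T1 = 0"
    using 1 by (simp add: \<Phi>_def Diff_eq_empty_iff[THEN iffD2])
  moreover have "\<Phi> T2 = real (card A + card B)"
    using 2 by (simp add: \<Phi>_def Diff_triv Int_absorb2)
  moreover have "card V - 3 \<le> card A" "card V - 3 \<le> card B"
    using card_crossing_fan[OF a_in_V b_in_V a_neq_b refl]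
      card_crossing_fan[OF b_in_V a_in_V a_neq_b[symmetric]]
    by (auto simp: A_def B_def insert_commute)
  ultimately have "2 * real (card V) - 6 \<le> \<Phi> T2 - \<Phi> T1"
    using V3 by linarith
  moreover have "ereal (\<Phi> T2 - \<Phi> T1) \<le> graph_dist (flip_graph M) T1 T2"
    using graph_dist_ge_potential[OF pair_wf_digraph_flip_graph] step by blast
  moreover have "graph_dist (flip_graph M) T1 T2 \<le> graph_diam (flip_graph M)"
    unfolding graph_diam_def using T1(1) T2(1)
    by (intro SUP_upper2[of "(T1, T2)"]) (auto simp: flip_graph_def)
  ultimately show ?thesis
    by (meson ereal_less_eq(3) order_trans)
qed

end

section \<open>Placing the puncture near an edge\<close>

text \<open>A facet of a two-dimensional polytope is a segment between two extreme points. Vertices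
  on both sides of it would be joined by a segment meeting the face, and would then belong to the
  face themselves.\<close>

lemma (in punctured_polygon) edge_exists:
  assumes "polytope P" "aff_dim P = 2"
  obtains a b where "a \<in> V" "b \<in> V" "a \<noteq> b" "\<And>v. v \<in> V - {a, b} \<Longrightarrow> orient a b v > 0"
proof -
  obtain F where "F facet_of P"
    using polytope_facet_exists[of P] assms by auto
  then have F: "F face_of P" "F \<noteq> {}" "aff_dim F = 1"
    using assms by (auto simp: facet_of_def)
  then have "compact F" "convex F"
    using assms(1) face_of_imp_compact face_of_imp_convex polytope_imp_compact polytope_imp_convex
    by blast+
  then obtain a b where Fab: "F = closed_segment a b"
    using compact_convex_collinear_segment[of F] F by (auto simp: collinear_aff_dim)
  have ab: "a \<noteq> b"
    using F(3) Fab by auto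
  have V: "a \<in> V" "b \<in> V"
    using extreme_point_of_face[OF F(1)] extreme_point_of_segment[of _ a b]
    by (auto simp: Fab V_eq polygon_vertices_def)
  have same: "orient a b v * orient a b t > 0" if vt: "v \<in> V - {a, b}" "t \<in> V - {a, b}" for v t
  proof -
    have "\<not> sep a b v t"
    proof
      assume "sep a b v t"
      then obtain q where q: "q \<in> open_segment a b" "q \<in> open_segment v t"
        using sep_imp_segments_meet V vt V_in_P by (metis DiffE)
      then have "v \<in> F"
        using face_ofD[OF F(1) q(2)] vt V_in_P by (auto simp: Fab open_segment_def)
      then have "v \<in> open_segment a b"
        using vt by (auto simp: Fab open_segment_def)
      then show False
        using vertex_extreme vt V V_in_P by blast
    qed
    moreover have "orient a b v \<noteq> 0" "orient a b t \<noteq> 0"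
      using orient_vertices_nonzero V vt ab by auto
    ultimately show ?thesis
      by (auto simp: sep_def not_less less_le)
  qed
  show ?thesis
  \<comment> \<open>All other vertices are on one side; if it is the negative one, \<open>a\<close>
    and \<open>b\<close> are exchanged.\<close>
  proof (cases "\<exists>t\<in>V - {a, b}. orient a b t < 0")
    case True
    then obtain t where t: "t \<in> V - {a, b}" "orient a b t < 0"
      by blast
    have "orient b a v > 0" if "v \<in> V - {b, a}" for v
      using same[of v t] that t by (auto simp: orient_swap[of b a] zero_less_mult_iff)
    then show ?thesis
      using that V ab by blast
  next
    case False
    have "orient a b v > 0" if "v \<in> V - {a, b}" for v
      using same[of v v] that False by (auto simp: zero_less_mult_iff)
    then show ?thesis
      using that V ab by blast
  qed
qed

text \<open>The strict inequalities hold at the midpoint of \<open>ab\<close>, where each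
  orientation is half of \<open>orient a b v\<close>. There are finitely many and they are
  continuous, so they persist close to the midpoint on the segment towards an interior
  point.\<close>

lemma (in punctured_polygon) near_edge_point:
  assumes "a \<in> V" "b \<in> V" "a \<noteq> b" "\<And>v. v \<in> V - {a, b} \<Longrightarrow> orient a b v > 0"
  obtains q where "q \<in> interior P" "\<And>v. v \<in> V - {a, b} \<Longrightarrow> orient a q v > 0 \<and> orient q b v > 0"
proof -
  define m where "m = (1 - 1/2) *\<^sub>R a + (1/2) *\<^sub>R b"
  have m: "orient a m v = orient a b v / 2" "orient m b v = orient a b v / 2" for v
    by (simp_all add: m_def orient_def field_simps)
  have "m \<in> closed_segment a b"
    unfolding m_def in_segment by (intro exI[of _ "1/2"]) auto
  then have "m \<in> P"
    using convex_P assms V_in_P by (meson closed_segment_subset subsetD)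
  define g where "g s = (1 - s) *\<^sub>R p + s *\<^sub>R m" for s :: real
  have gm: "g 1 = m"
    by (simp add: g_def)
  have cont: "((\<lambda>s. orient a (g s) v) \<longlongrightarrow> orient a (g 1) v) (at_left 1)"
    "((\<lambda>s. orient (g s) b v) \<longlongrightarrow> orient (g 1) b v) (at_left 1)" for v
    unfolding orient_def g_def by (intro tendsto_intros)+
  have "eventually (\<lambda>s. orient a (g s) v > 0 \<and> orient (g s) b v > 0) (at_left 1)"
    if "v \<in> V - {a, b}" for v
    using order_tendstoD(1)[OF cont(1)[of v], of 0] order_tendstoD(1)[OF cont(2)[of v], of 0]
      assms(4)[OF that] by (intro eventually_conj) (simp_all add: gm m)
  then have "eventually (\<lambda>s. \<forall>v\<in>V - {a, b}. orient a (g s) v > 0 \<and> orient (g s) b v > 0) (at_left 1)"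
    using finite_V by (simp add: eventually_ball_finite)
  moreover have "eventually (\<lambda>s::real. s \<in> {0<..<1}) (at_left 1)"
    by (intro eventually_at_leftI[of 0]) auto
  ultimately have "eventually (\<lambda>s. s \<in> {0<..<1} \<and>
    (\<forall>v\<in>V - {a, b}. orient a (g s) v > 0 \<and> orient (g s) b v > 0)) (at_left 1)"
    by (rule eventually_elim2) auto
  then have "\<exists>s. s \<in> {0<..<1} \<and> (\<forall>v\<in>V - {a, b}. orient a (g s) v > 0 \<and> orient (g s) b v > 0)"
    by (rule eventually_happens'[OF trivial_limit_at_left_real])
  then obtain s where s: "0 < s" "s < 1"
    "\<forall>v\<in>V - {a, b}. orient a (g s) v > 0 \<and> orient (g s) b v > 0"
    by auto
  have "g s \<in> interior P"
  \<comment> \<open>For \<open>p = m\<close> the open segment is empty, but the path is constant at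
    an interior point.\<close>
  proof (cases "p = m")
    case True
    then show ?thesis
      using p_interior by (simp add: g_def flip: scaleR_add_left)
  next
    case False
    then have "g s \<in> open_segment p m"
      using s by (auto simp: in_segment g_def)
    then show ?thesis
      using in_interior_closure_convex_segment[OF convex_P p_interior, of m] \<open>m \<in> P\<close> closure_subset
      by blast
  qed
  then show ?thesis
    using that s by blast
qed

lemma punctured_polygonI:
  assumes "convex_ngon n P" "p \<in> interior P"
  shows "punctured_polygon P (polygon_vertices P) p"
proof
  have poly: "polytope P"
    using assms by (simp add: convex_ngon_def)
  show "finite (polygon_vertices P)"
    using finite_polyhedron_extreme_points[OF polytope_imp_polyhedron[OF poly]]
    by (simp add: polygon_vertices_def)
  show "P = convex hull polygon_vertices P"
    unfolding polygon_vertices_def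
    using Krein_Milman_Minkowski polytope_imp_compact polytope_imp_convex poly by blast
qed (use assms in auto)

theorem theorem1p2:
  fixes n :: nat and P :: "(real^2) set"
  assumes "n \<ge> 3"
    and "convex_ngon n P"
  shows "(\<forall>p \<in> interior P.
            graph_diam (flip_graph (marked_points P p)) \<le> ereal (2 * real n - 6)) \<and>
         (\<exists>p \<in> interior P.
            graph_diam (flip_graph (marked_points P p)) \<ge> ereal (2 * real n - 8))"
proof (intro conjI ballI)
  define V where "V = polygon_vertices P"
  have n: "card V = n" and poly: "polytope P" "aff_dim P = 2"
    using assms by (simp_all add: V_def convex_ngon_def)
  have I: "punctured_polygon P V p" if "p \<in> interior P" for p
    using punctured_polygonI assms(2) that by (simp add: V_def)
  show "graph_diam (flip_graph (marked_points P p)) \<le> ereal (2 * real n - 6)"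
    if "p \<in> interior P" for p
    using punctured_polygon.flip_graph_diam_le[OF I[OF that]] assms(1) n
    by (simp add: marked_points_def V_def)
  have "rel_interior P = interior P"
    using poly by (intro rel_interior_interior) (simp add: aff_dim_eq_full[symmetric])
  moreover have "P \<noteq> {}"
    using poly by auto
  \<comment> \<open>An auxiliary puncture that makes the locale available for finding the edge and
    the actual placement.\<close>
  ultimately obtain c where "c \<in> interior P"
    using poly(1) rel_interior_eq_empty[of P] polytope_imp_convex by auto
  then interpret punctured_polygon P V c
    by (rule I)
  obtain a b where ab: "a \<in> V" "b \<in> V" "a \<noteq> b" "\<And>v. v \<in> V - {a, b} \<Longrightarrow> orient a b v > 0"
    using edge_exists[OF poly] by metis
  obtain p where p: "p \<in> interior P" "\<And>v. v \<in> V - {a, b} \<Longrightarrow> orient a p v > 0 \<and> orient p b v > 0"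
    using near_edge_point[OF ab] by metis
  interpret near: puncture_near_edge P V p a b
    using I[OF p(1)] ab p(2) by (simp add: puncture_near_edge_def puncture_near_edge_axioms_def)
  have "ereal (2 * real n - 8) \<le> ereal (2 * real n - 6)"
    by simp
  also have "\<dots> \<le> graph_diam (flip_graph (marked_points P p))"
    using near.flip_graph_diam_ge assms(1) n by (simp add: marked_points_def V_def)
  finally show "\<exists>p \<in> interior P. graph_diam (flip_graph (marked_points P p)) \<ge> ereal (2 * real n - 8)"
    using p(1) by blast
qed

end
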